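(* Let $\Gamma$ be a countable group with a finite symmetric generating set $S$, whose Cayley graph has no cycle of odd length. Let $(T,t,M)$ be a Perron-Frobenius type system for $(\Gamma,S)$. Define a new matrix $\tilde M$ indexed by $T$ by $\tilde M_{ij}=M_{ij}/p_i$, where $p_i$ is the number of predecessors of a point of type $i$ (it is given by $p_i=|S|-\sum_{k\in T}M_{ki}$). Since $\tilde M$ is Perron-Frobenius, its dominating eigenvalue $e^v$ is simple. Let $A=(A_i)_{i\in T}$ be a corresponding eigenvector with positive entries, $\tilde MA=e^vA$, let $D$ be the diagonal matrix with entries $A_i$, and let $M'=D^{-1/2}MD^{1/2}$. Define $$\lambda=\max_{|q|=1}\langle M'q,q\rangle,$$ where $q$ ranges over the Euclidean unit sphere of $\mathbb{R}^T$. Then the spectral radius $\rho$ of the simple random walk on $(\Gamma,S)$ satisfies $$\rho\geq\frac{2e^{-v/2}\lambda}{|S|}.$$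
   Context: Simple random walk on $(\Gamma,S)$: $X_0=e$ (the identity of $\Gamma$), and $X_{n+1}=X_ns$ with probability $1/|S|$ for each $s\in S$. Spectral radius: $\rho=\lim_n\mathbb{P}(X_{2n}=e)^{1/(2n)}$. Let $d$ be the word distance on $\Gamma$ associated with $S$. Since the Cayley graph has no cycle of odd length, any two neighbors $x,y$ satisfy $d(e,y)=d(e,x)\pm1$. The set of successors of $x$ is $\mathcal{S}(x)=\{y \text{ neighbor of } x: d(e,y)=d(e,x)+1\}$; the other neighbors of $x$ are its predecessors. Type system: let $T$ be a finite set, $t:\Gamma\to T$ a function and $M$ a square matrix indexed by $T$. The triple $(T,t,M)$ is a type system for $(\Gamma,S)$ if, for all $i,j\in T$, for all but finitely many $x\in\Gamma$ with $t(x)=j$, one has $\mathrm{Card}\{y\in\mathcal{S}(x): t(y)=i\}=M_{ij}$. The type system is Perron-Frobenius if the matrix $M$ is Perron-Frobenius, i.e., some power $M^n$ has only positive entries. *)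

theory Defs
  imports "HOL-Probability.Probability" "HOL-Algebra.Generated_Groups" "Graph_Theory.Arc_Walk"
begin

section \<open>Cayley graphs\<close>

definition cayley_graph :: "('a, 'b) monoid_scheme \<Rightarrow> 'a set \<Rightarrow> ('a, 'a \<times> 'a) pre_digraph" where
  "cayley_graph G S =
     \<lparr>verts = carrier G, arcs = {(x, x \<otimes>\<^bsub>G\<^esub> s) | x s. x \<in> carrier G \<and> s \<in> S}, tail = fst, head = snd\<rparr>"

definition symmetric_generating_set :: "('a, 'b) monoid_scheme \<Rightarrow> 'a set \<Rightarrow> bool" where
  "symmetric_generating_set G S \<longleftrightarrow>
     S \<subseteq> carrier G \<and> (\<forall>s\<in>S. m_inv G s \<in> S) \<and> generate G S = carrier G"

text \<open>In \<open>pre_digraph.cycle\<close> a loop is a cycle of length 1, so the following excludes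
  \<open>\<one> \<in> S\<close>. As \<open>S\<close> is symmetric, every edge of the Cayley graph appears with both
  orientations, and the directed cycles of length at least 3 are the usual cycles of the
  undirected graph.\<close>

definition no_odd_cycle :: "('a, 'b) pre_digraph \<Rightarrow> bool" where
  "no_odd_cycle H \<longleftrightarrow> (\<forall>p. pre_digraph.cycle H p \<longrightarrow> even (length p))"

definition word_dist :: "('a, 'b) monoid_scheme \<Rightarrow> 'a set \<Rightarrow> 'a \<Rightarrow> 'a \<Rightarrow> nat" where
  "word_dist G S x y =
     (LEAST n. \<exists>ss. length ss = n \<and> set ss \<subseteq> S \<and> y = foldl (\<lambda>u s. u \<otimes>\<^bsub>G\<^esub> s) x ss)"

definition neighbors :: "('a, 'b) monoid_scheme \<Rightarrow> 'a set \<Rightarrow> 'a \<Rightarrow> 'a set" where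
  "neighbors G S x = {y. (x, y) \<in> arcs (cayley_graph G S)}"

definition successors :: "('a, 'b) monoid_scheme \<Rightarrow> 'a set \<Rightarrow> 'a \<Rightarrow> 'a set" where
  "successors G S x =
     {y \<in> neighbors G S x. word_dist G S \<one>\<^bsub>G\<^esub> y = word_dist G S \<one>\<^bsub>G\<^esub> x + 1}"

definition predecessors :: "('a, 'b) monoid_scheme \<Rightarrow> 'a set \<Rightarrow> 'a \<Rightarrow> 'a set" where
  "predecessors G S x = neighbors G S x - successors G S x"

section \<open>Simple random walk and spectral radius\<close>

text \<open>The law of \<open>X\<^sub>n\<close>.\<close>

primrec srw :: "('a, 'b) monoid_scheme \<Rightarrow> 'a set \<Rightarrow> nat \<Rightarrow> 'a pmf" where
  "srw G S 0 = return_pmf \<one>\<^bsub>G\<^esub>"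
| "srw G S (Suc n) =
     bind_pmf (srw G S n) (\<lambda>x. map_pmf (\<lambda>s. x \<otimes>\<^bsub>G\<^esub> s) (pmf_of_set S))"

definition spectral_radius_srw :: "('a, 'b) monoid_scheme \<Rightarrow> 'a set \<Rightarrow> real" where
  "spectral_radius_srw G S =
     lim (\<lambda>n. pmf (srw G S (2 * n)) \<one>\<^bsub>G\<^esub> powr (1 / real (2 * n)))"

section \<open>Matrices\<close>

primrec mat_power :: "'a::semiring_1^'n^'n \<Rightarrow> nat \<Rightarrow> 'a^'n^'n" where
  "mat_power B 0 = mat 1"
| "mat_power B (Suc n) = B ** mat_power B n"

definition perron_frobenius :: "'a::linordered_semidom^'n^'n \<Rightarrow> bool" where
  "perron_frobenius B \<longleftrightarrow> (\<exists>n>0. \<forall>i j. mat_power B n $ i $ j > 0)"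

definition diag :: "('n \<Rightarrow> 'a::zero) \<Rightarrow> 'a^'n^'n" where
  "diag d = (\<chi> i j. if i = j then d i else 0)"

definition mat_eigenvalue :: "'a::field^'n^'n \<Rightarrow> 'a \<Rightarrow> bool" where
  "mat_eigenvalue B \<mu> \<longleftrightarrow> (\<exists>x. x \<noteq> 0 \<and> B *v x = \<mu> *s x)"

definition dominating_eigenvalue :: "real^'n^'n \<Rightarrow> real \<Rightarrow> bool" where
  "dominating_eigenvalue B \<mu> \<longleftrightarrow>
     mat_eigenvalue B \<mu> \<and>
     (\<forall>z. mat_eigenvalue (map_matrix complex_of_real B) z \<longrightarrow> cmod z \<le> \<mu>)"

section \<open>Type systems\<close>

text \<open>The finite set of types is the type \<open>'t\<close>. The entries of \<open>M\<close> are cardinalities,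
  hence natural numbers.\<close>

definition type_system ::
    "('a, 'b) monoid_scheme \<Rightarrow> 'a set \<Rightarrow> ('a \<Rightarrow> 't::finite) \<Rightarrow> nat^'t^'t \<Rightarrow> bool" where
  "type_system G S t M \<longleftrightarrow>
     (\<forall>i j. finite {x \<in> carrier G. t x = j \<and> card {y \<in> successors G S x. t y = i} \<noteq> M $ i $ j})"

text \<open>The number \<open>p\<^sub>i\<close> of predecessors of a point of type \<open>i\<close>; see
  \<open>card_predecessors_eq_pred_number\<close> below.\<close>

definition pred_number :: "'a set \<Rightarrow> nat^'t^'t \<Rightarrow> 't::finite \<Rightarrow> real" where
  "pred_number S M i = real (card S) - (\<Sum>k\<in>UNIV. real (M $ k $ i))"

definition M_tilde :: "'a set \<Rightarrow> nat^'t^'t \<Rightarrow> real^'t::finite^'t" where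
  "M_tilde S M = (\<chi> i j. real (M $ i $ j) / pred_number S M i)"

definition M_prime :: "nat^'t^'t \<Rightarrow> real^'t::finite \<Rightarrow> real^'t^'t" where
  "M_prime M A =
     diag (\<lambda>i. A $ i powr (- 1 / 2)) ** map_matrix real M ** diag (\<lambda>i. A $ i powr (1 / 2))"

definition max_quadratic_form :: "real^'n^'n \<Rightarrow> real" where
  "max_quadratic_form B = (GREATEST l. \<exists>q. norm q = 1 \<and> l = (B *v q) \<bullet> q)"

lemma neighbors_eq:
  assumes "x \<in> carrier G"
  shows "neighbors G S x = (\<lambda>s. x \<otimes>\<^bsub>G\<^esub> s) ` S"
  using assms by (auto simp: neighbors_def cayley_graph_def)

lemma card_predecessors_eq_pred_number:
  fixes G (structure) and t :: "'a \<Rightarrow> 't::finite"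
  assumes G: "group G" and S: "finite S" "symmetric_generating_set G S"
    and M: "type_system G S t M"
  shows "finite {x \<in> carrier G. t x = i \<and> real (card (predecessors G S x)) \<noteq> pred_number S M i}"
proof -
  interpret group G by fact
  have SG: "S \<subseteq> carrier G" using S(2) by (auto simp: symmetric_generating_set_def)
  let ?bad = "\<lambda>k. {x \<in> carrier G. t x = i \<and> card {y \<in> successors G S x. t y = k} \<noteq> M $ k $ i}"
  have "{x \<in> carrier G. t x = i \<and> real (card (predecessors G S x)) \<noteq> pred_number S M i}
          \<subseteq> (\<Union>k. ?bad k)"
  proof (rule subsetI, rule ccontr)
    fix x
    assume x: "x \<in> {x \<in> carrier G. t x = i \<and> real (card (predecessors G S x)) \<noteq> pred_number S M i}"
      and "x \<notin> (\<Union>k. ?bad k)"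
    then have eq: "card {y \<in> successors G S x. t y = k} = M $ k $ i" for k by auto
    have xG: "x \<in> carrier G" using x by simp
    have "inj_on (\<lambda>s. x \<otimes> s) S" using inj_on_cmult[OF xG] SG by (rule inj_on_subset)
    then have card: "card (neighbors G S x) = card S"
      by (simp add: neighbors_eq[OF xG] card_image)
    have fin: "finite (neighbors G S x)" using S(1) by (simp add: neighbors_eq[OF xG])
    have sub: "successors G S x \<subseteq> neighbors G S x" by (auto simp: successors_def)
    have fs: "finite (successors G S x)" using fin sub finite_subset by blast
    have "card (successors G S x) = card (\<Union>k\<in>UNIV. {y \<in> successors G S x. t y = k})"
      by (rule arg_cong[where f = card]) auto
    also have "\<dots> = (\<Sum>k\<in>UNIV. card {y \<in> successors G S x. t y = k})"
      using fs by (intro card_UN_disjoint) auto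
    finally have "card (successors G S x) = (\<Sum>k\<in>UNIV. M $ k $ i)" by (simp add: eq)
    moreover have "real (card (predecessors G S x)) = real (card S) - real (card (successors G S x))"
      using card_Diff_subset[OF fs sub] card_mono[OF fin sub] card
      by (simp add: predecessors_def of_nat_diff)
    ultimately show False using x by (simp add: pred_number_def)
  qed
  moreover have "finite (\<Union>k. ?bad k)" using M by (auto simp: type_system_def)
  ultimately show ?thesis by (rule finite_subset)
qed

end

theory Submission
  imports Defs "HOL-Real_Asymp.Real_Asymp"
begin

text \<open>Let \<open>W\<close> be the adjacency operator of the Cayley graph, so that the transition operator of the walk is
\<open>W / |S|\<close>. Both are symmetric, and the spectral radius dominates every Rayleigh quotient
(\<open>Rayleigh_quotient_le_spectral_radius\<close>): \<open>\<langle>W f, f\<rangle> \<le> |S| \<rho> \<langle>f, f\<rangle>\<close> for each finitely supported \<open>f\<close>. The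
theorem is obtained by inserting good test functions. The inequality itself comes from log-convexity:
\<open>n \<mapsto> \<parallel>W\<^sup>n f\<parallel>\<^sup>2\<close> is log-convex by Cauchy-Schwarz, hence grows at least at the rate given by the Rayleigh
quotient of \<open>f\<close>, while it is at most a constant times \<open>\<parallel>W\<^sup>n \<delta>\<parallel>\<^sup>2\<close>, a multiple of the return
probability at time \<open>2 n\<close>. For \<open>f = \<delta>\<close> log-convexity also shows that the roots of the return
probabilities increase, so that the limit defining \<open>\<rho>\<close> exists.

The test functions are \<open>f x = \<beta> (t x) exp (- v d(x) / 2)\<close> on a shell \<open>m \<le> d(x) \<le> n\<close> and \<open>0\<close> elsewhere. Let
\<open>N\<^sub>k i\<close> be the number of points of type \<open>i\<close> at distance \<open>k\<close>. As there are no odd cycles, all edges join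
consecutive spheres, and counting those that end in points of type \<open>i\<close> gives
\<open>p\<^sub>i N\<^sub>k\<^sub>+\<^sub>1 i = (\<Sum>j. M\<^sub>i\<^sub>j N\<^sub>k j)\<close> for large \<open>k\<close> (\<open>sphere_count_Suc\<close>). In other words, from some index on
the vectors \<open>N\<^sub>k\<close> are iterates of \<open>M_tilde\<close>. Normalised by \<open>A\<close> and \<open>exp v\<close>, they are iterates of a primitive stochastic matrix, and
therefore \<open>exp (- v k) N\<^sub>k i \<longlonglongrightarrow> c A\<^sub>i\<close> for some \<open>c > 0\<close> if the group is infinite
(\<open>sphere_count_asymptotics\<close>). So, up to bounded errors, each sphere of the shell contributes
\<open>c (\<Sum>i. A\<^sub>i \<beta>\<^sub>i\<^sup>2)\<close> to \<open>\<langle>f, f\<rangle>\<close> and \<open>2 exp (- v / 2) c (\<Sum>i j. M\<^sub>i\<^sub>j A\<^sub>j \<beta>\<^sub>i \<beta>\<^sub>j)\<close> to \<open>\<langle>W f, f\<rangle>\<close>. The substitution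
\<open>q\<^sub>i = sqrt A\<^sub>i \<beta>\<^sub>i\<close> turns the two sums into \<open>|q|\<^sup>2\<close> and \<open>\<langle>M' q, q\<rangle>\<close>; a maximising \<open>q\<close> and wide shells give
the bound.

If the group is finite, there are no distant spheres and the type system carries no information on the
graph. Then \<open>\<rho> \<ge> 1\<close>, and the right-hand side is at most \<open>1\<close> for purely algebraic reasons: apply
the inequality of arithmetic and geometric means to the products \<open>\<beta>\<^sub>i \<beta>\<^sub>j\<close> and use the eigenvector equation and
the column sums of \<open>M\<close> (\<open>edge_form_le\<close>).\<close>

section \<open>Word distance in Cayley graphs\<close>

locale symmetric_cayley = group G for G (structure) +
  fixes S :: "'a set"
  assumes finite_S: "finite S"
    and generating: "symmetric_generating_set G S"
begin

abbreviation dist_one :: "'a \<Rightarrow> nat" where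
  "dist_one x \<equiv> word_dist G S \<one> x"

abbreviation walk_end :: "'a \<Rightarrow> 'a list \<Rightarrow> 'a" where
  "walk_end x ss \<equiv> foldl (\<lambda>u s. u \<otimes> s) x ss"

lemma S_carrier: "s \<in> S \<Longrightarrow> s \<in> carrier G"
  and S_inv: "s \<in> S \<Longrightarrow> inv s \<in> S"
  using generating by (auto simp: symmetric_generating_set_def)

lemma walk_end_carrier: "x \<in> carrier G \<Longrightarrow> set ss \<subseteq> S \<Longrightarrow> walk_end x ss \<in> carrier G"
  by (induction ss arbitrary: x) (auto simp: S_carrier)

lemma walk_end_mult:
  "x \<in> carrier G \<Longrightarrow> y \<in> carrier G \<Longrightarrow> set ss \<subseteq> S \<Longrightarrow> walk_end (x \<otimes> y) ss = x \<otimes> walk_end y ss"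
  by (induction ss arbitrary: y) (auto simp: S_carrier m_assoc)

lemma walk_end_reverse:
  "x \<in> carrier G \<Longrightarrow> set ss \<subseteq> S \<Longrightarrow> walk_end (walk_end x ss) (rev (map (m_inv G) ss)) = x"
  by (induction ss arbitrary: x) (auto simp: S_carrier m_assoc)

lemma ex_word:
  assumes "x \<in> carrier G"
  shows "\<exists>ss. set ss \<subseteq> S \<and> x = walk_end \<one> ss"
proof -
  have "x \<in> generate G S" using assms generating by (simp add: symmetric_generating_set_def)
  then show ?thesis
  proof (induction rule: generate.induct)
    case one
    then show ?case by (intro exI[of _ "[]"]) auto
  next
    case (incl h)
    then show ?case by (intro exI[of _ "[h]"]) (auto simp: S_carrier)
  next
    case (inv h)
    then show ?case by (intro exI[of _ "[m_inv G h]"]) (auto simp: S_carrier S_inv)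
  next
    case (eng h1 h2)
    then obtain ss1 ss2 where w: "set ss1 \<subseteq> S" "h1 = walk_end \<one> ss1" "set ss2 \<subseteq> S" "h2 = walk_end \<one> ss2"
      by auto
    have "walk_end h1 ss2 = h1 \<otimes> h2"
      using walk_end_mult[of h1 \<one> ss2] walk_end_carrier[of \<one> ss1] w by simp
    with w show ?case by (intro exI[of _ "ss1 @ ss2"]) auto
  qed
qed

lemma geodesic_word:
  assumes "x \<in> carrier G"
  obtains ss where "length ss = dist_one x" "set ss \<subseteq> S" "x = walk_end \<one> ss"
proof -
  have "\<exists>n ss. length ss = n \<and> set ss \<subseteq> S \<and> x = walk_end \<one> ss" using ex_word[OF assms] by auto
  from LeastI_ex[OF this] show ?thesis using that unfolding word_dist_def by blast
qed

lemma dist_one_le: "set ss \<subseteq> S \<Longrightarrow> dist_one (walk_end \<one> ss) \<le> length ss"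
  unfolding word_dist_def by (rule Least_le) auto

lemma dist_one_step:
  assumes "x \<in> carrier G" "s \<in> S"
  shows "dist_one (x \<otimes> s) \<le> dist_one x + 1"
proof -
  obtain ss where "length ss = dist_one x" "set ss \<subseteq> S" "x = walk_end \<one> ss"
    using geodesic_word[OF assms(1)] .
  then show ?thesis using dist_one_le[of "ss @ [s]"] assms by simp
qed

lemma finite_ball: "finite {x \<in> carrier G. dist_one x \<le> n}"
proof (rule finite_subset)
  show "{x \<in> carrier G. dist_one x \<le> n} \<subseteq> walk_end \<one> ` {ss. set ss \<subseteq> S \<and> length ss \<le> n}"
    by (auto elim!: geodesic_word)
  show "finite (walk_end \<one> ` {ss. set ss \<subseteq> S \<and> length ss \<le> n})"
    using finite_lists_length_le[OF finite_S] by auto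
qed

lemma neighbors_carrier: "x \<in> carrier G \<Longrightarrow> y \<in> neighbors G S x \<Longrightarrow> y \<in> carrier G"
  by (auto simp: neighbors_eq S_carrier)

lemma neighbors_sym:
  assumes "x \<in> carrier G" "y \<in> neighbors G S x"
  shows "x \<in> neighbors G S y"
proof -
  obtain s where s: "s \<in> S" "y = x \<otimes> s" using assms by (auto simp: neighbors_eq)
  then have "x = y \<otimes> inv s" using assms by (simp add: m_assoc S_carrier)
  then show ?thesis using neighbors_eq[of y G S] s assms by (auto simp: S_inv S_carrier)
qed

lemma finite_neighbors: "x \<in> carrier G \<Longrightarrow> finite (neighbors G S x)"
  by (simp add: neighbors_eq finite_S)

lemma sum_neighbors: "x \<in> carrier G \<Longrightarrow> (\<Sum>y\<in>neighbors G S x. f y) = (\<Sum>s\<in>S. f (x \<otimes> s))"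
  using inj_on_subset[OF inj_on_cmult, of x S]
  by (simp add: neighbors_eq sum.reindex S_carrier subset_iff)

end

text \<open>If the walk visits a vertex twice before it closes up, it splits at this vertex into two shorter closed walks, one of which is
again odd.\<close>

lemma (in wf_digraph) odd_closed_walk_imp_odd_cycle:
  assumes "awalk u p u" "odd (length p)"
  shows "\<exists>c. cycle c \<and> odd (length c)"
  using assms
proof (induction "length p" arbitrary: p u rule: less_induct)
  case less
  then obtain e es where p: "p = e # es" by (cases p) auto
  show ?case
  proof (cases "distinct (tl (awalk_verts u p))")
    case True
    then show ?thesis using less.prems p by (intro exI[of _ p]) (auto simp: cycle_def)
  next
    case False
    then have *: "awalk (head G e) es u" "\<not> distinct (awalk_verts (head G e) es)"
      using p less.prems by (auto simp: awalk_Cons_iff)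
    from awalk_not_distinct_decomp[OF *] obtain q r s w where
      d: "es = q @ r @ s" "0 < length r" "awalk (head G e) q w" "awalk w r w" "awalk w s u"
      by auto
    show ?thesis
    proof (cases "odd (length r)")
      case True
      then show ?thesis using less.hyps[of r w] d p by auto
    next
      case False
      have "awalk u (e # q @ s) u" using d p less.prems by (auto simp: awalk_Cons_iff)
      moreover have "odd (length (e # q @ s))" using less.prems False d p by auto
      ultimately show ?thesis using less.hyps[of "e # q @ s" u] d p by auto
    qed
  qed
qed

locale bipartite_cayley = symmetric_cayley +
  assumes no_odd: "no_odd_cycle (cayley_graph G S)"
begin

lemma walk_end_awalk:
  "x \<in> carrier G \<Longrightarrow> set ss \<subseteq> S \<Longrightarrow>
    \<exists>p. length p = length ss \<and> pre_digraph.awalk (cayley_graph G S) x p (walk_end x ss)"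
proof (induction ss arbitrary: x)
  case Nil
  then show ?case by (intro exI[of _ "[]"]) (auto simp: pre_digraph.awalk_def pre_digraph.cas.simps cayley_graph_def)
next
  case (Cons s ss)
  then have "x \<otimes> s \<in> carrier G" "set ss \<subseteq> S" by (auto simp: S_carrier)
  from Cons.IH[OF this] obtain p where "length p = length ss"
    "pre_digraph.awalk (cayley_graph G S) (x \<otimes> s) p (walk_end (x \<otimes> s) ss)" by blast
  then show ?case using Cons.prems
    by (intro exI[of _ "(x, x \<otimes> s) # p"]) (auto simp: pre_digraph.awalk_def pre_digraph.cas.simps cayley_graph_def)
qed

lemma closed_word_even:
  assumes "x \<in> carrier G" "set ss \<subseteq> S" "walk_end x ss = x"
  shows "even (length ss)"
proof (rule ccontr)
  assume odd: "odd (length ss)"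
  interpret wf_digraph "cayley_graph G S"
    by unfold_locales (auto simp: cayley_graph_def S_carrier)
  obtain p where "length p = length ss" "awalk x p x"
    using walk_end_awalk[OF assms(1,2)] assms(3) by auto
  then show False
    using odd_closed_walk_imp_odd_cycle[of x p] odd no_odd by (auto simp: no_odd_cycle_def)
qed

text \<open>Go from the identity to \<open>x\<close> along a geodesic, cross the edge, and return from \<open>y\<close> along a geodesic. This
closed walk has length \<open>d(x) + d(y) + 1\<close>, which is even,
so \<open>d(x) \<noteq> d(y)\<close>.\<close>

lemma dist_one_neighbor:
  assumes x: "x \<in> carrier G" and y: "y \<in> neighbors G S x"
  shows "dist_one y = dist_one x + 1 \<or> dist_one x = dist_one y + 1"
proof -
  obtain s where s: "s \<in> S" "y = x \<otimes> s" using x y by (auto simp: neighbors_eq)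
  have yc: "y \<in> carrier G" using neighbors_carrier[OF x y] .
  obtain s' where s': "s' \<in> S" "x = y \<otimes> s'" using neighbors_sym[OF x y] yc by (auto simp: neighbors_eq)
  obtain ss where ss: "length ss = dist_one x" "set ss \<subseteq> S" "x = walk_end \<one> ss"
    using geodesic_word[OF x] .
  obtain ts where ts: "length ts = dist_one y" "set ts \<subseteq> S" "y = walk_end \<one> ts"
    using geodesic_word[OF yc] .
  let ?ws = "ss @ s # rev (map (m_inv G) ts)"
  have "walk_end \<one> ?ws = walk_end y (rev (map (m_inv G) ts))" using ss s by simp
  also have "\<dots> = \<one>" using walk_end_reverse[of \<one> ts] ts by simp
  finally have "even (length ?ws)" using ss ts s by (intro closed_word_even) (auto simp: S_inv)
  then have "dist_one x \<noteq> dist_one y" using ss ts by auto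
  moreover have "dist_one y \<le> dist_one x + 1" using dist_one_step x s by simp
  moreover have "dist_one x \<le> dist_one y + 1" using dist_one_step yc s' by simp
  ultimately show ?thesis by linarith
qed

lemma predecessors_iff_successors:
  assumes "x \<in> carrier G" "y \<in> carrier G"
  shows "x \<in> predecessors G S y \<longleftrightarrow> y \<in> successors G S x"
proof -
  have "x \<in> neighbors G S y \<longleftrightarrow> y \<in> neighbors G S x"
    using assms neighbors_sym by blast
  moreover have "dist_one x \<noteq> dist_one y + 1 \<longleftrightarrow> dist_one y = dist_one x + 1"
    if "y \<in> neighbors G S x"
    using dist_one_neighbor[OF assms(1) that] by linarith
  ultimately show ?thesis
    unfolding predecessors_def successors_def Diff_iff mem_Collect_eq by blast
qed

lemma of_bool_neighbors:
  assumes "x \<in> carrier G" "y \<in> carrier G"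
  shows "of_bool (y \<in> neighbors G S x)
    = of_bool (y \<in> successors G S x) + (of_bool (x \<in> successors G S y) :: real)"
proof -
  have "x \<in> neighbors G S y \<longleftrightarrow> y \<in> neighbors G S x"
    using assms neighbors_sym by blast
  moreover have "dist_one x \<noteq> dist_one y + 1 \<longleftrightarrow> dist_one y = dist_one x + 1"
    if "y \<in> neighbors G S x"
    using dist_one_neighbor[OF assms(1) that] by linarith
  ultimately have "y \<in> neighbors G S x \<longleftrightarrow> y \<in> successors G S x \<or> x \<in> successors G S y"
    and "\<not> (y \<in> successors G S x \<and> x \<in> successors G S y)"
    unfolding successors_def mem_Collect_eq by (blast, linarith)
  then show ?thesis by auto
qed

end

section \<open>The adjacency operator on finitely supported functions\<close>

definition finitely_supported :: "('a, 'b) monoid_scheme \<Rightarrow> ('a \<Rightarrow> real) \<Rightarrow> bool" where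
  "finitely_supported G f \<longleftrightarrow> finite {x \<in> carrier G. f x \<noteq> 0}"

text \<open>The sum runs over the whole carrier for all functions, so that it can be re-indexed by bijections of the group
without any reference to supports.\<close>

definition inner_carrier :: "('a, 'b) monoid_scheme \<Rightarrow> ('a \<Rightarrow> real) \<Rightarrow> ('a \<Rightarrow> real) \<Rightarrow> real" where
  "inner_carrier G f g = (\<Sum>\<^sub>\<infinity>x\<in>carrier G. f x * g x)"

lemma inner_carrier_commute: "inner_carrier G f g = inner_carrier G g f"
  by (simp add: inner_carrier_def mult.commute)

lemma inner_carrier_eq_sum:
  assumes "finite B" "B \<subseteq> carrier G" "\<And>x. x \<in> carrier G \<Longrightarrow> x \<notin> B \<Longrightarrow> f x * g x = 0"
  shows "inner_carrier G f g = (\<Sum>x\<in>B. f x * g x)"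
proof -
  have "inner_carrier G f g = (\<Sum>\<^sub>\<infinity>x\<in>B. f x * g x)"
    unfolding inner_carrier_def using assms by (intro infsum_cong_neutral) auto
  then show ?thesis using assms(1) by simp
qed

lemma inner_carrier_sq_nonneg: "inner_carrier G f f \<ge> 0"
  unfolding inner_carrier_def by (rule infsum_nonneg) auto

lemma inner_carrier_Cauchy_Schwarz:
  assumes "finitely_supported G f" "finitely_supported G g"
  shows "(inner_carrier G f g)\<^sup>2 \<le> inner_carrier G f f * inner_carrier G g g"
proof -
  define B where "B = {x \<in> carrier G. f x \<noteq> 0} \<union> {x \<in> carrier G. g x \<noteq> 0}"
  have fB: "finite B" and B: "B \<subseteq> carrier G" using assms by (auto simp: B_def finitely_supported_def)
  have "inner_carrier G h k = (\<Sum>x\<in>B. h x * k x)" if "h \<in> {f, g}" "k \<in> {f, g}" for h k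
    using that by (intro inner_carrier_eq_sum fB B) (auto simp: B_def)
  then show ?thesis
    using Cauchy_Schwarz_ineq_sum[of f g B] by (simp add: power2_eq_square)
qed

lemma infsum_sum_finite_support:
  fixes h :: "'b \<Rightarrow> 'a \<Rightarrow> real"
  assumes "finite I" "\<And>i. i \<in> I \<Longrightarrow> finite {x \<in> A. h i x \<noteq> 0}"
  shows "(\<Sum>\<^sub>\<infinity>x\<in>A. \<Sum>i\<in>I. h i x) = (\<Sum>i\<in>I. \<Sum>\<^sub>\<infinity>x\<in>A. h i x)"
proof (rule infsumI)
  show "((\<lambda>x. \<Sum>i\<in>I. h i x) has_sum (\<Sum>i\<in>I. \<Sum>\<^sub>\<infinity>x\<in>A. h i x)) A"
    using assms
  proof (induction I rule: finite_induct)
    case (insert i I)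
    have "(h i has_sum infsum (h i) A) A"
      using insert.prems by (intro has_sum_infsum finite_nonzero_values_imp_summable_on) auto
    then show ?case using insert by (simp add: has_sum_add)
  qed simp
qed

context symmetric_cayley
begin

definition walk_sum :: "('a \<Rightarrow> real) \<Rightarrow> 'a \<Rightarrow> real" where
  "walk_sum f x = (\<Sum>s\<in>S. f (x \<otimes> s))"

abbreviation delta :: "'a \<Rightarrow> 'a \<Rightarrow> real" where
  "delta y x \<equiv> of_bool (x = y)"

lemma bij_betw_right_mult:
  assumes "a \<in> carrier G"
  shows "bij_betw (\<lambda>x. x \<otimes> a) (carrier G) (carrier G)"
  by (rule bij_betw_byWitness[where f' = "\<lambda>x. x \<otimes> inv a"]) (use assms in \<open>auto simp: m_assoc\<close>)

lemma bij_betw_left_mult: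
  assumes "a \<in> carrier G"
  shows "bij_betw (\<lambda>x. a \<otimes> x) (carrier G) (carrier G)"
  by (rule bij_betw_byWitness[where f' = "\<lambda>x. inv a \<otimes> x"]) (use assms in \<open>auto simp: m_assoc[symmetric]\<close>)

lemma sum_S_inv: "(\<Sum>s\<in>S. f (inv s)) = (\<Sum>s\<in>S. f s)"
  by (rule sum.reindex_bij_betw, rule bij_betw_byWitness[where f' = "m_inv G"])
     (auto simp: S_inv S_carrier)

lemma finitely_supported_delta: "finitely_supported G (delta y)"
  unfolding finitely_supported_def by (rule finite_subset[of _ "{y}"]) auto

lemma finitely_supported_walk_sum:
  assumes "finitely_supported G f"
  shows "finitely_supported G (walk_sum f)"
  unfolding finitely_supported_def
proof (rule finite_subset)
  let ?F = "{x \<in> carrier G. f x \<noteq> 0}"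
  show "finite (\<Union>s\<in>S. (\<lambda>x. x \<otimes> inv s) ` ?F)"
    using assms finite_S by (auto simp: finitely_supported_def)
  show "{x \<in> carrier G. walk_sum f x \<noteq> 0} \<subseteq> (\<Union>s\<in>S. (\<lambda>x. x \<otimes> inv s) ` ?F)"
  proof
    fix x assume "x \<in> {x \<in> carrier G. walk_sum f x \<noteq> 0}"
    then have x: "x \<in> carrier G" "walk_sum f x \<noteq> 0" by auto
    then obtain s where s: "s \<in> S" "f (x \<otimes> s) \<noteq> 0"
      unfolding walk_sum_def by (meson sum.neutral)
    have "x = (x \<otimes> s) \<otimes> inv s" using x s by (simp add: m_assoc S_carrier)
    then show "x \<in> (\<Union>s\<in>S. (\<lambda>x. x \<otimes> inv s) ` ?F)"
      using s x by (intro UN_I[of s] image_eqI[of _ _ "x \<otimes> s"]) (auto simp: S_carrier)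
  qed
qed

lemma finitely_supported_walk_sum_funpow:
  "finitely_supported G f \<Longrightarrow> finitely_supported G ((walk_sum ^^ n) f)"
  by (induction n) (auto simp: finitely_supported_walk_sum)

lemma finite_support_shift:
  assumes "finitely_supported G f" "a \<in> carrier G"
  shows "finite {x \<in> carrier G. f (x \<otimes> a) \<noteq> 0}"
proof (rule finite_subset)
  show "{x \<in> carrier G. f (x \<otimes> a) \<noteq> 0} \<subseteq> (\<lambda>x. x \<otimes> inv a) ` {x \<in> carrier G. f x \<noteq> 0}"
  proof
    fix x assume "x \<in> {x \<in> carrier G. f (x \<otimes> a) \<noteq> 0}"
    then show "x \<in> (\<lambda>x. x \<otimes> inv a) ` {x \<in> carrier G. f x \<noteq> 0}"
      using assms(2) by (intro image_eqI[of _ _ "x \<otimes> a"]) (auto simp: m_assoc)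
  qed
qed (use assms in \<open>auto simp: finitely_supported_def\<close>)

text \<open>In the sum that belongs to \<open>s\<close> take \<open>x s\<close> as the new variable, and then replace \<open>s\<close> by \<open>inv s\<close>, using that \<open>S\<close>
is closed under inverses.\<close>

lemma walk_sum_symmetric:
  assumes f: "finitely_supported G f" and g: "finitely_supported G g"
  shows "inner_carrier G (walk_sum f) g = inner_carrier G f (walk_sum g)"
proof -
  have "inner_carrier G (walk_sum f) g = (\<Sum>\<^sub>\<infinity>x\<in>carrier G. \<Sum>s\<in>S. f (x \<otimes> s) * g x)"
    by (simp add: inner_carrier_def walk_sum_def sum_distrib_right)
  also have "\<dots> = (\<Sum>s\<in>S. \<Sum>\<^sub>\<infinity>x\<in>carrier G. f (x \<otimes> s) * g x)"
    by (intro infsum_sum_finite_support finite_S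
          finite_subset[OF _ finite_support_shift[OF f]]) (auto simp: S_carrier)
  also have "\<dots> = (\<Sum>s\<in>S. \<Sum>\<^sub>\<infinity>x\<in>carrier G. f x * g (x \<otimes> inv s))"
  proof (rule sum.cong)
    fix s assume s: "s \<in> S"
    have "(\<Sum>\<^sub>\<infinity>x\<in>carrier G. f (x \<otimes> s) * g x)
        = (\<Sum>\<^sub>\<infinity>x\<in>carrier G. f (x \<otimes> s) * g ((x \<otimes> s) \<otimes> inv s))"
      using s by (intro infsum_cong) (simp add: m_assoc S_carrier)
    also have "\<dots> = (\<Sum>\<^sub>\<infinity>x\<in>carrier G. f x * g (x \<otimes> inv s))"
      using infsum_reindex_bij_betw[OF bij_betw_right_mult[OF S_carrier[OF s]],
          of "\<lambda>x. f x * g (x \<otimes> inv s)"] .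
    finally show "(\<Sum>\<^sub>\<infinity>x\<in>carrier G. f (x \<otimes> s) * g x)
        = (\<Sum>\<^sub>\<infinity>x\<in>carrier G. f x * g (x \<otimes> inv s))" .
  qed simp
  also have "\<dots> = (\<Sum>s\<in>S. \<Sum>\<^sub>\<infinity>x\<in>carrier G. f x * g (x \<otimes> s))"
    using sum_S_inv[of "\<lambda>s. \<Sum>\<^sub>\<infinity>x\<in>carrier G. f x * g (x \<otimes> s)"] .
  also have "\<dots> = (\<Sum>\<^sub>\<infinity>x\<in>carrier G. \<Sum>s\<in>S. f x * g (x \<otimes> s))"
    by (intro infsum_sum_finite_support[symmetric] finite_S
          finite_subset[OF _ finite_support_shift[OF g]]) (auto simp: S_carrier)
  also have "\<dots> = inner_carrier G f (walk_sum g)"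
    by (simp add: inner_carrier_def walk_sum_def sum_distrib_left)
  finally show ?thesis .
qed

lemma walk_sum_funpow_symmetric:
  assumes f: "finitely_supported G f" and g: "finitely_supported G g"
  shows "inner_carrier G ((walk_sum ^^ n) f) g = inner_carrier G f ((walk_sum ^^ n) g)"
  using f
proof (induction n arbitrary: f)
  case (Suc n)
  then show ?case
    using walk_sum_symmetric[of f "(walk_sum ^^ n) g"] finitely_supported_walk_sum_funpow[OF g]
    by (simp add: funpow_swap1[of walk_sum n] finitely_supported_walk_sum)
qed simp

lemma inner_carrier_delta: "y \<in> carrier G \<Longrightarrow> inner_carrier G f (delta y) = f y"
  using inner_carrier_eq_sum[of "{y}" G f "delta y"] by simp

lemma walk_sum_funpow_translate:
  assumes "y \<in> carrier G" "x \<in> carrier G"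
  shows "(walk_sum ^^ n) (delta y) x = (walk_sum ^^ n) (delta \<one>) (inv y \<otimes> x)"
  using assms(2)
proof (induction n arbitrary: x)
  case 0
  have "inv y \<otimes> x = \<one> \<longleftrightarrow> x = y"
  proof
    assume "inv y \<otimes> x = \<one>"
    then have "y \<otimes> (inv y \<otimes> x) = y \<otimes> \<one>" by simp
    then show "x = y" using 0 assms(1) by (simp add: m_assoc[symmetric])
  qed (use assms(1) in simp)
  then show ?case by simp
next
  case (Suc n)
  then show ?case using assms(1) by (simp add: walk_sum_def S_carrier m_assoc)
qed

text \<open>For \<open>f = delta \<one>\<close> this is, up to the factor \<open>|S|\<^sup>2\<^sup>n\<close>, the probability of being back at the identity at time
\<open>2 n\<close>.\<close>

definition walk_norm2 :: "('a \<Rightarrow> real) \<Rightarrow> nat \<Rightarrow> real" where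
  "walk_norm2 f n = inner_carrier G ((walk_sum ^^ n) f) ((walk_sum ^^ n) f)"

lemma walk_norm2_nonneg: "walk_norm2 f n \<ge> 0"
  by (simp add: walk_norm2_def inner_carrier_sq_nonneg)

text \<open>The walk is invariant under left translations, as its steps multiply on the right.\<close>

lemma walk_norm2_delta:
  assumes "y \<in> carrier G"
  shows "walk_norm2 (delta y) n = walk_norm2 (delta \<one>) n"
proof -
  let ?h = "\<lambda>x. (walk_sum ^^ n) (delta \<one>) x * (walk_sum ^^ n) (delta \<one>) x"
  have "walk_norm2 (delta y) n = (\<Sum>\<^sub>\<infinity>x\<in>carrier G. ?h (inv y \<otimes> x))"
    unfolding walk_norm2_def inner_carrier_def
    using assms by (intro infsum_cong) (simp add: walk_sum_funpow_translate[OF assms])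
  also have "\<dots> = walk_norm2 (delta \<one>) n"
    unfolding walk_norm2_def inner_carrier_def
    using infsum_reindex_bij_betw[OF bij_betw_left_mult[OF inv_closed[OF assms]], of ?h] .
  finally show ?thesis .
qed

lemma walk_norm2_eq:
  assumes "finitely_supported G f"
  shows "walk_norm2 f n = inner_carrier G ((walk_sum ^^ (2 * n)) f) f"
  using walk_sum_funpow_symmetric[OF assms finitely_supported_walk_sum_funpow[OF assms, of n], of n]
  by (simp add: walk_norm2_def mult_2 funpow_add inner_carrier_commute)

text \<open>By symmetry one factor \<open>W\<close> can be moved to the other side,
\<open>\<langle>W\<^sup>n\<^sup>+\<^sup>1 f, W\<^sup>n\<^sup>+\<^sup>1 f\<rangle> = \<langle>W\<^sup>n f, W\<^sup>n\<^sup>+\<^sup>2 f\<rangle>\<close>; then apply Cauchy-Schwarz.\<close>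

lemma walk_norm2_log_convex:
  assumes f: "finitely_supported G f"
  shows "(walk_norm2 f (Suc n))\<^sup>2 \<le> walk_norm2 f n * walk_norm2 f (Suc (Suc n))"
proof -
  let ?g = "\<lambda>n. (walk_sum ^^ n) f"
  have "walk_norm2 f (Suc n) = inner_carrier G (?g n) (?g (Suc (Suc n)))"
    using walk_sum_symmetric[of "?g n" "?g (Suc n)"] finitely_supported_walk_sum_funpow[OF f]
    by (simp add: walk_norm2_def finitely_supported_walk_sum)
  then show ?thesis
    using inner_carrier_Cauchy_Schwarz[of G "?g n" "?g (Suc (Suc n))"]
      finitely_supported_walk_sum_funpow[OF f]
    by (simp add: walk_norm2_def finitely_supported_walk_sum)
qed

text \<open>Expand \<open>\<langle>W\<^sup>2\<^sup>n f, f\<rangle>\<close> bilinearly in the values of \<open>f\<close>. Each matrix entry of \<open>W\<^sup>2\<^sup>n\<close> is an inner product of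
two functions \<open>W\<^sup>n \<delta>\<^sub>x\<close> and \<open>W\<^sup>n \<delta>\<^sub>y\<close>, so by Cauchy-Schwarz and transitivity it is at most the diagonal entry.\<close>

lemma walk_norm2_le:
  assumes f: "finitely_supported G f"
  shows "walk_norm2 f n \<le> (\<Sum>x | x \<in> carrier G \<and> f x \<noteq> 0. \<bar>f x\<bar>)\<^sup>2 * walk_norm2 (delta \<one>) n"
proof -
  define B where "B = {x \<in> carrier G. f x \<noteq> 0}"
  have fB: "finite B" and B: "B \<subseteq> carrier G"
    and B0: "x \<in> carrier G \<Longrightarrow> x \<notin> B \<Longrightarrow> f x = 0" for x
    using f by (auto simp: B_def finitely_supported_def)
  let ?W = "walk_sum ^^ (2 * n)" and ?a = "walk_norm2 (delta \<one>) n"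
  have entry: "\<bar>?W (delta y) x\<bar> \<le> ?a" if "x \<in> carrier G" "y \<in> carrier G" for x y
  proof -
    have "?W (delta y) x = inner_carrier G ((walk_sum ^^ n) ((walk_sum ^^ n) (delta y))) (delta x)"
      using that by (simp add: inner_carrier_delta mult_2 funpow_add)
    also have "\<dots> = inner_carrier G ((walk_sum ^^ n) (delta y)) ((walk_sum ^^ n) (delta x))"
      by (intro walk_sum_funpow_symmetric finitely_supported_walk_sum_funpow finitely_supported_delta)
    finally have "(?W (delta y) x)\<^sup>2 \<le> walk_norm2 (delta y) n * walk_norm2 (delta x) n"
      using inner_carrier_Cauchy_Schwarz[of G "(walk_sum ^^ n) (delta y)" "(walk_sum ^^ n) (delta x)"]
      by (simp add: walk_norm2_def finitely_supported_walk_sum_funpow finitely_supported_delta)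
    also have "\<dots> = ?a\<^sup>2" using that by (simp add: walk_norm2_delta[of x] walk_norm2_delta[of y] power2_eq_square)
    finally show ?thesis
      using abs_le_square_iff[of "?W (delta y) x" ?a] walk_norm2_nonneg[of "delta \<one>" n] by simp
  qed
  have val: "\<bar>?W f y\<bar> \<le> (\<Sum>x\<in>B. \<bar>f x\<bar>) * ?a" if "y \<in> carrier G" for y
  proof -
    have "?W f y = inner_carrier G f (?W (delta y))"
      using walk_sum_funpow_symmetric[OF f finitely_supported_delta, of "2 * n" y] that
      by (simp add: inner_carrier_delta)
    also have "\<dots> = (\<Sum>x\<in>B. f x * ?W (delta y) x)"
      by (rule inner_carrier_eq_sum) (auto simp: fB B B0 subsetD[OF B])
    finally have "\<bar>?W f y\<bar> \<le> (\<Sum>x\<in>B. \<bar>f x * ?W (delta y) x\<bar>)" by (simp add: sum_abs)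
    also have "\<dots> \<le> (\<Sum>x\<in>B. \<bar>f x\<bar> * ?a)"
      using entry that B by (intro sum_mono) (auto simp: abs_mult intro!: mult_left_mono)
    finally show ?thesis by (simp add: sum_distrib_right)
  qed
  have "walk_norm2 f n = (\<Sum>x\<in>B. ?W f x * f x)"
    unfolding walk_norm2_eq[OF f] by (rule inner_carrier_eq_sum) (auto simp: fB B B0 subsetD[OF B])
  also have "\<dots> \<le> (\<Sum>x\<in>B. ((\<Sum>x\<in>B. \<bar>f x\<bar>) * ?a) * \<bar>f x\<bar>)"
  proof (rule sum_mono)
    fix x assume "x \<in> B"
    have "?W f x * f x \<le> \<bar>?W f x\<bar> * \<bar>f x\<bar>" by (metis abs_ge_self abs_mult)
    also have "\<dots> \<le> ((\<Sum>x\<in>B. \<bar>f x\<bar>) * ?a) * \<bar>f x\<bar>"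
      using val \<open>x \<in> B\<close> B by (intro mult_right_mono) auto
    finally show "?W f x * f x \<le> ((\<Sum>x\<in>B. \<bar>f x\<bar>) * ?a) * \<bar>f x\<bar>" .
  qed
  also have "\<dots> = (\<Sum>x\<in>B. \<bar>f x\<bar>)\<^sup>2 * ?a"
    unfolding sum_distrib_left[symmetric] by (simp add: power2_eq_square algebra_simps)
  finally show ?thesis by (simp add: B_def)
qed

lemma set_pmf_srw:
  assumes "S \<noteq> {}"
  shows "set_pmf (srw G S n) \<subseteq> carrier G"
  using assms finite_S by (induction n) (auto simp: set_pmf_of_set S_carrier)

text \<open>Condition on the last step: the walk is at \<open>x\<close> at time \<open>n + 1\<close> after the step \<open>s\<close> iff it was at \<open>x (inv s)\<close> at time \<open>n\<close>. As
\<open>S\<close> is symmetric, \<open>inv s\<close> can be replaced by \<open>s\<close> in the sum.\<close>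

lemma pmf_srw:
  assumes ne: "S \<noteq> {}" and x: "x \<in> carrier G"
  shows "pmf (srw G S n) x = (walk_sum ^^ n) (delta \<one>) x / real (card S) ^ n"
  using x
proof (induction n arbitrary: x)
  case 0
  then show ?case by (simp add: indicator_def)
next
  case (Suc n)
  have "pmf (srw G S (Suc n)) x
      = pmf (bind_pmf (pmf_of_set S) (\<lambda>s. map_pmf (\<lambda>y. y \<otimes> s) (srw G S n))) x"
    using bind_commute_pmf[of "srw G S n" "pmf_of_set S" "\<lambda>y s. return_pmf (y \<otimes> s)"]
    by (simp add: map_pmf_def)
  also have "\<dots> = (\<Sum>s\<in>S. pmf (map_pmf (\<lambda>y. y \<otimes> s) (srw G S n)) x) / real (card S)"
    using ne finite_S by (simp add: pmf_bind integral_pmf_of_set)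
  also have "\<dots> = (\<Sum>s\<in>S. pmf (srw G S n) (x \<otimes> inv s)) / real (card S)"
  proof (intro arg_cong2[where f = "(/)"] sum.cong refl)
    fix s assume s: "s \<in> S"
    have inj: "inj_on (\<lambda>y. y \<otimes> s) (carrier G)"
      using bij_betw_right_mult[OF S_carrier[OF s]] by (rule bij_betw_imp_inj_on)
    have "pmf (map_pmf (\<lambda>y. y \<otimes> s) (srw G S n)) ((x \<otimes> inv s) \<otimes> s) = pmf (srw G S n) (x \<otimes> inv s)"
    proof (cases "x \<otimes> inv s \<in> set_pmf (srw G S n)")
      case True
      show ?thesis
        using inj_on_subset[OF inj set_pmf_srw[OF ne, of n]] True by (rule pmf_map_inj)
    next
      case False
      have "(x \<otimes> inv s) \<otimes> s \<notin> (\<lambda>y. y \<otimes> s) ` set_pmf (srw G S n)"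
        using inj_on_image_mem_iff[OF inj _ set_pmf_srw[OF ne, of n]] False Suc.prems s
        by (simp add: S_carrier)
      then show ?thesis using False by (simp add: pmf_map_outside pmf_eq_0_set_pmf)
    qed
    moreover have "(x \<otimes> inv s) \<otimes> s = x" using s Suc.prems by (simp add: m_assoc S_carrier)
    ultimately show "pmf (map_pmf (\<lambda>y. y \<otimes> s) (srw G S n)) x = pmf (srw G S n) (x \<otimes> inv s)" by simp
  qed
  also have "\<dots> = (\<Sum>s\<in>S. pmf (srw G S n) (x \<otimes> s)) / real (card S)"
    using sum_S_inv[of "\<lambda>s. pmf (srw G S n) (x \<otimes> s)"] by simp
  also have "\<dots> = (walk_sum ^^ Suc n) (delta \<one>) x / real (card S) ^ Suc n"
    using Suc walk_sum_def[of "(walk_sum ^^ n) (delta \<one>)" x]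
    by (simp add: S_carrier sum_divide_distrib[symmetric] mult.commute)
  finally show ?case .
qed

lemma pmf_srw_return:
  assumes "S \<noteq> {}"
  shows "pmf (srw G S (2 * n)) \<one> = walk_norm2 (delta \<one>) n / real (card S) ^ (2 * n)"
  using assms by (simp add: pmf_srw walk_norm2_eq finitely_supported_delta inner_carrier_delta)

end

section \<open>Log-convex sequences\<close>

lemma
  fixes c :: "nat \<Rightarrow> real"
  assumes c0: "c 0 = 1" and c1: "c 1 > 0"
    and lc: "\<And>n. (c (Suc n))\<^sup>2 \<le> c n * c (Suc (Suc n))"
  shows log_convex_pos: "c n > 0"
    and log_convex_power_le: "c n ^ Suc n \<le> c (Suc n) ^ n"
proof -
  have pos: "c n > 0 \<and> c (Suc n) > 0" for n
  proof (induction n)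
    case (Suc n)
    have "0 < (c (Suc n))\<^sup>2" using Suc by simp
    also have "\<dots> \<le> c n * c (Suc (Suc n))" by (rule lc)
    finally show ?case using Suc by (simp add: zero_less_mult_iff)
  qed (use c0 c1 in auto)
  then show "c n > 0" by blast
  \<comment> \<open>The slope of the convex function \<open>ln c\<close> between \<open>0\<close> and \<open>n\<close> increases with \<open>n\<close>.\<close>
  show "c n ^ Suc n \<le> c (Suc n) ^ n"
  proof (induction n)
    case (Suc n)
    have p: "c n > 0" "c (Suc n) > 0" "c (Suc (Suc n)) > 0" using pos by blast+
    have "c (Suc n) ^ n * c (Suc n) ^ Suc (Suc n) = ((c (Suc n))\<^sup>2) ^ Suc n"
      by (simp add: power_mult[symmetric] power_add[symmetric] mult_2 del: power_Suc)
    also have "\<dots> \<le> (c n * c (Suc (Suc n))) ^ Suc n" using lc by (intro power_mono) auto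
    also have "\<dots> = c n ^ Suc n * c (Suc (Suc n)) ^ Suc n" by (rule power_mult_distrib)
    also have "\<dots> \<le> c (Suc n) ^ n * c (Suc (Suc n)) ^ Suc n"
      using Suc p by (intro mult_right_mono) auto
    finally show ?case using p by (simp del: power_Suc)
  qed (use c0 in simp)
qed

text \<open>The index \<open>0\<close> is left out: there the exponent \<open>1 / 0\<close> has the default value \<open>0\<close>, which makes the power equal to \<open>1\<close> and can
break monotonicity.\<close>

lemma log_convex_powr_mono:
  fixes c :: "nat \<Rightarrow> real"
  assumes c0: "c 0 = 1" and c1: "c 1 > 0"
    and lc: "\<And>n. (c (Suc n))\<^sup>2 \<le> c n * c (Suc (Suc n))"
  shows "incseq (\<lambda>n. c (Suc n) powr (1 / real (Suc n)))"
proof (rule incseq_SucI)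
  fix n
  have p: "c (Suc n) > 0" "c (Suc (Suc n)) > 0" using log_convex_pos[of c, OF assms] by blast+
  have "c (Suc n) ^ Suc (Suc n) \<le> c (Suc (Suc n)) ^ Suc n" using assms by (rule log_convex_power_le)
  then have "ln (c (Suc n) ^ Suc (Suc n)) \<le> ln (c (Suc (Suc n)) ^ Suc n)"
    using p by (subst ln_le_cancel_iff) (auto simp del: power_Suc)
  then have "real (Suc (Suc n)) * ln (c (Suc n)) \<le> real (Suc n) * ln (c (Suc (Suc n)))"
    using p by (simp only: ln_realpow)
  then have "ln (c (Suc n)) / real (Suc n) \<le> ln (c (Suc (Suc n))) / real (Suc (Suc n))"
    by (simp add: divide_le_eq le_divide_eq mult.commute del: of_nat_Suc)
  then show "c (Suc n) powr (1 / real (Suc n)) \<le> c (Suc (Suc n)) powr (1 / real (Suc (Suc n)))"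
    using p by (simp add: powr_def)
qed

lemma log_convex_ge_power:
  fixes c :: "nat \<Rightarrow> real"
  assumes c0: "c 0 = 1" and c1: "c 1 > 0"
    and lc: "\<And>n. (c (Suc n))\<^sup>2 \<le> c n * c (Suc (Suc n))"
  shows "c 1 ^ n \<le> c n"
proof (cases n)
  case (Suc m)
  have p: "c (Suc m) > 0" using log_convex_pos[of c, OF assms] by blast
  have "c (Suc 0) powr (1 / real (Suc 0)) \<le> c (Suc m) powr (1 / real (Suc m))"
    using incseqD[OF log_convex_powr_mono[of c, OF assms], of 0 m] by simp
  then have "c 1 \<le> c (Suc m) powr (1 / real (Suc m))" using c1 by simp
  then have "c 1 ^ Suc m \<le> (c (Suc m) powr (1 / real (Suc m))) ^ Suc m"
    using c1 by (intro power_mono) auto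
  also have "\<dots> = c (Suc m)"
    using p by (simp add: powr_power del: power_Suc)
  finally show ?thesis using Suc by simp
qed (use c0 in simp)

section \<open>The spectral radius bounds Rayleigh quotients\<close>

context symmetric_cayley
begin

text \<open>The return probabilities \<open>a\<^sub>n\<close> at even times are log-convex with \<open>a\<^sub>0 = 1\<close>, so their roots increase; being
probabilities, they are bounded.\<close>

lemma spectral_radius_srw_LIMSEQ:
  assumes ne: "S \<noteq> {}"
  shows "(\<lambda>n. pmf (srw G S (2 * n)) \<one> powr (1 / real (2 * n))) \<longlonglongrightarrow> spectral_radius_srw G S"
proof -
  let ?a = "\<lambda>n. pmf (srw G S (2 * n)) \<one>"
  have card: "real (card S) > 0" using ne finite_S by (simp add: card_gt_0_iff)
  have a0: "?a 0 = 1" by simp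
  have lc: "(?a (Suc n))\<^sup>2 \<le> ?a n * ?a (Suc (Suc n))" for n
  proof -
    have eq: "(real (card S) ^ (2 * Suc n))\<^sup>2 = real (card S) ^ (2 * n) * real (card S) ^ (2 * Suc (Suc n))"
      unfolding power_mult[symmetric] power_add[symmetric] by (rule arg_cong2[where f = power]) auto
    then show ?thesis
      unfolding pmf_srw_return[OF ne] power_divide times_divide_times_eq eq
      by (intro divide_right_mono walk_norm2_log_convex finitely_supported_delta) auto
  qed
  \<comment> \<open>Log-convexity propagates positivity, so it is enough that the walk can step out and back.\<close>
  have "?a 1 > 0"
  proof -
    obtain s where s: "s \<in> S" using ne by auto
    have "walk_sum (delta \<one>) (inv s) > 0"
      unfolding walk_sum_def using s finite_S
      by (intro sum_pos2[of _ s]) (auto simp: S_carrier)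
    moreover have "walk_norm2 (delta \<one>) 1 \<ge> (walk_sum (delta \<one>) (inv s))\<^sup>2"
    proof -
      have "(walk_sum (delta \<one>) (inv s))\<^sup>2 = (\<Sum>\<^sub>\<infinity>x\<in>{inv s}. walk_sum (delta \<one>) x * walk_sum (delta \<one>) x)"
        by (simp add: power2_eq_square)
      also have "\<dots> \<le> (\<Sum>\<^sub>\<infinity>x\<in>carrier G. walk_sum (delta \<one>) x * walk_sum (delta \<one>) x)"
        using finitely_supported_walk_sum[OF finitely_supported_delta, of \<one>] s
        by (intro infsum_mono2 finite_nonzero_values_imp_summable_on)
           (auto simp: finitely_supported_def S_carrier)
      finally show ?thesis by (simp add: walk_norm2_def inner_carrier_def)
    qed
    ultimately have "walk_norm2 (delta \<one>) 1 > 0" by (smt (verit) zero_less_power)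
    then show ?thesis unfolding pmf_srw_return[OF ne] using card by simp
  qed
  note mono = log_convex_powr_mono[of ?a, OF a0 this lc]
  have "convergent (\<lambda>n. ?a (Suc n) powr (1 / real (Suc n)))"
  proof (rule Bseq_monoseq_convergent)
    show "monoseq (\<lambda>n. ?a (Suc n) powr (1 / real (Suc n)))"
      using mono by (simp add: monoseq_def incseq_def)
    show "Bseq (\<lambda>n. ?a (Suc n) powr (1 / real (Suc n)))"
      by (intro BseqI'[where K = 1]) (auto intro!: powr_le1 simp: pmf_le_1)
  qed
  then obtain L where "(\<lambda>n. ?a (Suc n) powr (1 / real (Suc n))) \<longlonglongrightarrow> L"
    by (auto simp: convergent_def)
  then have "(\<lambda>n. ?a n powr (1 / real n)) \<longlonglongrightarrow> L" by (rule LIMSEQ_imp_Suc)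
  then have "(\<lambda>n. (?a n powr (1 / real n)) powr (1 / 2)) \<longlonglongrightarrow> L powr (1 / 2)"
    by (intro tendsto_powr') auto
  then have "(\<lambda>n. ?a n powr (1 / real (2 * n))) \<longlonglongrightarrow> L powr (1 / 2)"
    by (simp add: powr_powr mult.commute)
  then show ?thesis unfolding spectral_radius_srw_def by (simp only: limI)
qed

text \<open>Let \<open>\<kappa>\<close> be the Rayleigh quotient, assumed positive. Cauchy-Schwarz gives \<open>\<parallel>W f\<parallel> \<ge> \<kappa> \<parallel>f\<parallel>\<close>, log-convexity improves
this to \<open>\<parallel>W\<^sup>n f\<parallel> \<ge> \<kappa>\<^sup>n \<parallel>f\<parallel>\<close>, and the comparison with the return probabilities loses only a constant
factor, which the roots of order \<open>2 n\<close> remove in the limit.\<close>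

lemma Rayleigh_quotient_le_spectral_radius:
  assumes ne: "S \<noteq> {}" and f: "finitely_supported G f"
  shows "inner_carrier G (walk_sum f) f
    \<le> real (card S) * spectral_radius_srw G S * inner_carrier G f f"
proof -
  let ?a = "\<lambda>n. pmf (srw G S (2 * n)) \<one>" and ?k = "real (card S)" and ?\<rho> = "spectral_radius_srw G S"
  define c where "c = walk_norm2 f"
  define r where "r = inner_carrier G (walk_sum f) f"
  define C where "C = (\<Sum>x | x \<in> carrier G \<and> f x \<noteq> 0. \<bar>f x\<bar>)\<^sup>2"
  have k: "?k > 0" using ne finite_S by (simp add: card_gt_0_iff)
  have c_0: "c 0 = inner_carrier G f f" by (simp add: c_def walk_norm2_def)
  have rho: "?\<rho> \<ge> 0" by (rule LIMSEQ_le_const[OF spectral_radius_srw_LIMSEQ[OF ne]]) auto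
  have CS: "r\<^sup>2 \<le> c 1 * c 0"
    using inner_carrier_Cauchy_Schwarz[of G "walk_sum f" f] f
    by (simp add: r_def c_def walk_norm2_def finitely_supported_walk_sum)
  show ?thesis
  proof (cases "r \<le> 0")
    case True
    have "0 \<le> ?k * ?\<rho> * inner_carrier G f f" using rho inner_carrier_sq_nonneg[of G f] by simp
    then show ?thesis using True by (simp add: r_def)
  next
    case False
    then have r: "r > 0" by simp
    then have "0 < r\<^sup>2" by simp
    then have "c 1 * c 0 > 0" using CS by linarith
    then have c0: "c 0 > 0" and c1: "c 1 > 0"
      using walk_norm2_nonneg[of f 0] walk_norm2_nonneg[of f 1]
      by (auto simp: c_def zero_less_mult_iff)
    have lc: "(c (Suc n) / c 0)\<^sup>2 \<le> (c n / c 0) * (c (Suc (Suc n)) / c 0)" for n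
      using walk_norm2_log_convex[OF f, of n] c0
      by (simp add: c_def power_divide power2_eq_square divide_right_mono)
    have C: "C > 0"
    proof -
      have "0 < C * walk_norm2 (delta \<one>) 0" using c0 walk_norm2_le[OF f, of 0] by (simp add: c_def C_def)
      then show ?thesis using walk_norm2_nonneg[of "delta \<one>" 0] by (simp add: zero_less_mult_iff)
    qed
    define \<kappa> where "\<kappa> = r / c 0"
    have \<kappa>: "\<kappa> > 0" using r c0 by (simp add: \<kappa>_def)
    have bound: "c 0 / C * (\<kappa> / ?k) ^ (2 * n) \<le> ?a n" for n
    proof -
      have "\<kappa>\<^sup>2 \<le> c 1 / c 0" using CS c0 by (simp add: \<kappa>_def power_divide power2_eq_square field_simps)
      then have "(\<kappa>\<^sup>2) ^ n \<le> (c 1 / c 0) ^ n" by (intro power_mono) auto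
      also have "\<dots> \<le> c n / c 0"
        using log_convex_ge_power[of "\<lambda>n. c n / c 0" n] c0 c1 lc by simp
      finally have "c 0 * \<kappa> ^ (2 * n) \<le> c n" using c0 unfolding power_mult by (simp add: field_simps)
      also have "\<dots> \<le> C * walk_norm2 (delta \<one>) n" using walk_norm2_le[OF f] by (simp add: c_def C_def)
      also have "\<dots> = C * (?a n * ?k ^ (2 * n))" unfolding pmf_srw_return[OF ne] using k by simp
      finally show ?thesis using C k by (simp add: field_simps power_divide)
    qed
    have "(\<lambda>n. 1 / real (2 * n)) \<longlonglongrightarrow> 0" by real_asymp
    then have "(\<lambda>n. (c 0 / C) powr (1 / real (2 * n))) \<longlonglongrightarrow> (c 0 / C) powr 0"
      using c0 C by (intro tendsto_powr tendsto_const) auto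
    from tendsto_mult_right[OF this, of "\<kappa> / ?k"]
    have lim: "(\<lambda>n. (c 0 / C) powr (1 / real (2 * n)) * (\<kappa> / ?k)) \<longlonglongrightarrow> \<kappa> / ?k"
      using c0 C by simp
    have "\<kappa> / ?k \<le> ?\<rho>"
    proof (rule LIMSEQ_le[OF lim spectral_radius_srw_LIMSEQ[OF ne]], intro exI allI impI)
      fix n :: nat assume n: "n \<ge> 1"
      define q where "q = \<kappa> / ?k"
      have q: "q > 0" using \<kappa> k by (simp add: q_def)
      have "(q ^ (2 * n)) powr (1 / real (2 * n)) = q"
        using q n powr_powr[of q "real (2 * n)" "1 / real (2 * n)"] powr_realpow[OF q, of "2 * n"] by simp
      then have "(c 0 / C) powr (1 / real (2 * n)) * (\<kappa> / ?k)
          = (c 0 / C * (\<kappa> / ?k) ^ (2 * n)) powr (1 / real (2 * n))"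
        unfolding q_def[symmetric] using c0 C q by (subst powr_mult) auto
      also have "\<dots> \<le> ?a n powr (1 / real (2 * n))"
        using c0 C \<kappa> k by (intro powr_mono2 bound) auto
      finally show "(c 0 / C) powr (1 / real (2 * n)) * (\<kappa> / ?k) \<le> ?a n powr (1 / real (2 * n))" .
    qed
    then show ?thesis using c0 k by (simp add: \<kappa>_def r_def c_0 field_simps)
  qed
qed

end

section \<open>Iteration of primitive stochastic matrices\<close>

lemma stochastic_lower_bound:
  fixes Q :: "'t::finite \<Rightarrow> 't \<Rightarrow> real"
  assumes Q0: "\<And>i j. Q i j \<ge> 0" and Q1: "\<And>i. (\<Sum>j\<in>UNIV. Q i j) = 1"
    and u: "\<And>n i. u (Suc n) i = (\<Sum>j\<in>UNIV. Q i j * u n j)"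
    and l: "\<And>j. l \<le> u n j"
  shows "l \<le> u (n + k) i"
proof (induction k arbitrary: i)
  case (Suc k)
  have "l = (\<Sum>j\<in>UNIV. Q i j * l)" by (simp add: sum_distrib_right[symmetric] Q1)
  also have "\<dots> \<le> (\<Sum>j\<in>UNIV. Q i j * u (n + k) j)"
    using Suc Q0 by (intro sum_mono mult_left_mono) auto
  finally show ?case by (simp add: u)
qed (simp add: l)

text \<open>If all coordinates at time \<open>n\<close> are at least \<open>l\<close>, then a definite share of the excess \<open>u n j - l\<close> of coordinate \<open>j\<close>
reaches coordinate \<open>i\<close> after \<open>k\<close> steps, provided that \<open>M\<close> has a path of length \<open>k\<close> from \<open>j\<close> to \<open>i\<close>. The factor
\<open>\<delta>\<close> depends on \<open>k\<close> only. Positivity of the entries is read off \<open>M\<close>, whose support lies in that of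
\<open>Q\<close>, so that powers of \<open>Q\<close> do not occur.\<close>

lemma stochastic_growth:
  fixes Q :: "'t::finite \<Rightarrow> 't \<Rightarrow> real" and M :: "nat^'t^'t"
  assumes Q0: "\<And>i j. Q i j \<ge> 0" and Q1: "\<And>i. (\<Sum>j\<in>UNIV. Q i j) = 1"
    and QM: "\<And>i j. M $ i $ j > 0 \<Longrightarrow> Q i j > 0"
    and u: "\<And>n i. u (Suc n) i = (\<Sum>j\<in>UNIV. Q i j * u n j)"
  shows "\<exists>\<delta>>0. \<forall>i j n l. mat_power M k $ i $ j > 0 \<longrightarrow> (\<forall>j. l \<le> u n j) \<longrightarrow>
    l + \<delta> * (u n j - l) \<le> u (n + k) i"
proof (induction k)
  case 0
  have "i = j" if "mat_power M 0 $ i $ j > 0" for i j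
    using that by (simp add: mat_def split: if_splits)
  then show ?case by (intro exI[of _ 1]) auto
next
  case (Suc k)
  then obtain \<delta> where \<delta>: "\<delta> > 0" and IH: "\<And>i j n l. mat_power M k $ i $ j > 0 \<Longrightarrow>
    (\<forall>j. l \<le> u n j) \<Longrightarrow> l + \<delta> * (u n j - l) \<le> u (n + k) i" by meson
  define \<epsilon> where "\<epsilon> = Min (insert 1 {Q i j | i j. M $ i $ j > 0})"
  have fin: "finite {Q i j | i j. M $ i $ j > 0}"
    by (rule finite_subset[of _ "range (case_prod Q)"]) auto
  have \<epsilon>: "\<epsilon> > 0" unfolding \<epsilon>_def using fin QM by (subst Min_gr_iff) auto
  have \<epsilon>_le: "\<epsilon> \<le> Q i j" if "M $ i $ j > 0" for i j
    unfolding \<epsilon>_def using fin that by (intro Min_le) auto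
  show ?case
  proof (intro exI[of _ "\<epsilon> * \<delta>"] conjI allI impI)
    show "\<epsilon> * \<delta> > 0" using \<epsilon> \<delta> by simp
    fix i j n l
    assume pos: "mat_power M (Suc k) $ i $ j > 0" and "\<forall>j. l \<le> u n j"
    then have l: "\<And>j. l \<le> u n j" by blast
    have "(\<Sum>m\<in>UNIV. M $ i $ m * mat_power M k $ m $ j) > 0"
      using pos by (simp add: matrix_matrix_mult_def)
    then obtain m where m: "M $ i $ m * mat_power M k $ m $ j \<noteq> 0"
      using sum.neutral by (metis (no_types, lifting) less_irrefl)
    have low: "l \<le> u (n + k) j" for j
      by (rule stochastic_lower_bound[where Q = Q and u = u, OF Q0 Q1 u l])
    have "l + \<delta> * (u n j - l) \<le> u (n + k) m" using IH[of m j l n] m l by simp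
    then have "\<epsilon> * (\<delta> * (u n j - l)) \<le> \<epsilon> * (u (n + k) m - l)"
      using \<epsilon> by (intro mult_left_mono) auto
    also have "\<dots> \<le> Q i m * (u (n + k) m - l)"
      using \<epsilon>_le[of i m] m low[of m] by (intro mult_right_mono) auto
    also have "\<dots> \<le> (\<Sum>m\<in>UNIV. Q i m * (u (n + k) m - l))"
      using low Q0 by (intro member_le_sum) auto
    also have "\<dots> = u (n + Suc k) i - l"
      by (simp add: u right_diff_distrib sum_subtractf sum_distrib_right[symmetric] Q1)
    finally show "l + \<epsilon> * \<delta> * (u n j - l) \<le> u (n + Suc k) i" by (simp add: mult.assoc)
  qed
qed

text \<open>The minimum over all coordinates increases and the maximum decreases. Over a period in which the power of \<open>M\<close> is
positive, the minimum gains a fixed share of the gap between them, and so the gap tends to \<open>0\<close>.\<close>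

lemma primitive_stochastic_iteration_converges:
  fixes Q :: "'t::finite \<Rightarrow> 't \<Rightarrow> real" and M :: "nat^'t^'t"
  assumes Q0: "\<And>i j. Q i j \<ge> 0" and Q1: "\<And>i. (\<Sum>j\<in>UNIV. Q i j) = 1"
    and QM: "\<And>i j. M $ i $ j > 0 \<Longrightarrow> Q i j > 0" and M: "perron_frobenius M"
    and u: "\<And>n i. u (Suc n) i = (\<Sum>j\<in>UNIV. Q i j * u n j)"
    and u0: "\<And>i. u 0 i \<ge> 0" and pos: "u 0 i0 > 0"
  shows "\<exists>c>0. \<forall>i. (\<lambda>n. u n i) \<longlonglongrightarrow> c"
proof -
  define a where "a n = Min (range (u n))" for n
  define b where "b n = Max (range (u n))" for n
  have a_le: "a n \<le> u n i" and le_b: "u n i \<le> b n" for n i by (auto simp: a_def b_def)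
  have a_step: "a n \<le> a (n + k)" for n k
  proof -
    have "a n \<le> u (n + k) i" for i by (rule stochastic_lower_bound[where Q = Q and u = u and l = "a n" and n = n, OF Q0 Q1 u a_le])
    then show ?thesis unfolding a_def[of "n + k"] by (intro Min.boundedI) auto
  qed
  have b_step: "b (n + k) \<le> b n" for n k
  proof -
    have "- b n \<le> - u (n + k) i" for i
      by (rule stochastic_lower_bound[where Q = Q and u = "\<lambda>n i. - u n i", OF Q0 Q1])
         (auto simp: u le_b sum_negf)
    then show ?thesis unfolding b_def[of "n + k"] by (intro Max.boundedI) auto
  qed
  obtain m where m: "\<And>i j. mat_power M m $ i $ j > 0" using M by (auto simp: perron_frobenius_def)
  obtain \<delta> where \<delta>: "\<delta> > 0" and growth: "\<And>i j n l. (\<And>j. l \<le> u n j) \<Longrightarrow>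
      l + \<delta> * (u n j - l) \<le> u (n + m) i"
    using stochastic_growth[of Q M u m, OF Q0 Q1 QM u] m by blast
  have gap: "a n + \<delta> * (b n - a n) \<le> a (n + m)" for n
  proof -
    have "b n \<in> range (u n)" unfolding b_def by (intro Max_in) auto
    then obtain j where "b n = u n j" by auto
    then have "a n + \<delta> * (b n - a n) \<le> u (n + m) i" for i using growth[OF a_le, of n j i] by simp
    then show ?thesis unfolding a_def[of "n + m"] by (intro Min.boundedI) auto
  qed
  have ab: "a n \<le> b n" for n using a_le[of n i0] le_b[of n i0] by linarith
  have a_mono: "incseq a"
  proof (rule incseq_SucI)
    show "a n \<le> a (Suc n)" for n using a_step[of n 1] by simp
  qed
  have b_mono: "decseq b"
  proof (rule decseq_SucI)
    show "b (Suc n) \<le> b n" for n using b_step[of n 1] by simp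
  qed
  have "\<forall>n. a n \<le> b 0" using ab b_step[of 0] order_trans by fastforce
  then obtain \<alpha> where \<alpha>: "a \<longlonglongrightarrow> \<alpha>" and a_le_\<alpha>: "\<forall>n. a n \<le> \<alpha>" using incseq_convergent[OF a_mono] by blast
  have "\<forall>n. a 0 \<le> b n" using ab a_step[of 0] order_trans by fastforce
  then obtain \<beta> where \<beta>: "b \<longlonglongrightarrow> \<beta>" using decseq_convergent[OF b_mono] by blast
  have "\<alpha> + \<delta> * (\<beta> - \<alpha>) \<le> \<alpha>"
    by (rule LIMSEQ_le[of "\<lambda>n. a n + \<delta> * (b n - a n)" _ "\<lambda>n. a (n + m)"])
       (use gap \<alpha> \<beta> in \<open>auto intro!: tendsto_intros LIMSEQ_ignore_initial_segment\<close>)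
  then have "\<beta> \<le> \<alpha>" using \<delta> by (simp add: mult_le_0_iff)
  moreover have "\<alpha> \<le> \<beta>" using LIMSEQ_le[OF \<alpha> \<beta>] ab by blast
  ultimately have eq: "\<beta> = \<alpha>" by simp
  have "(\<lambda>n. u n i) \<longlonglongrightarrow> \<alpha>" for i
    by (rule tendsto_sandwich[OF _ _ \<alpha> \<beta>[unfolded eq]]) (auto simp: a_le le_b)
  moreover have "\<alpha> > 0"
  proof -
    have a0: "a 0 \<ge> 0" unfolding a_def using u0 by (intro Min.boundedI) auto
    have b0: "b 0 > 0" using le_b[of 0 i0] pos by linarith
    have "0 < a 0 + \<delta> * (b 0 - a 0)"
    proof (cases "a 0 = 0")
      case False
      then show ?thesis using a0 ab[of 0] \<delta> by (intro add_pos_nonneg) auto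
    qed (use \<delta> b0 in simp)
    then show ?thesis using gap[of 0] a_le_\<alpha> by (metis add_0 less_le_trans)
  qed
  ultimately show ?thesis by blast
qed

section \<open>The quadratic form and the Perron eigenvector\<close>

lemma max_quadratic_form_attained:
  fixes B :: "real^'n^'n"
  obtains q where "norm q = 1" "max_quadratic_form B = (B *v q) \<bullet> q"
proof -
  have "continuous_on (sphere 0 1) (\<lambda>q. (B *v q) \<bullet> q)"
    by (intro continuous_intros linear_continuous_on matrix_vector_mul_bounded_linear)
  moreover have "sphere (0 :: real^'n) 1 \<noteq> {}" by simp
  ultimately obtain q where "q \<in> sphere 0 1" "\<forall>y\<in>sphere 0 1. (B *v y) \<bullet> y \<le> (B *v q) \<bullet> q"
    using continuous_attains_sup[OF compact_sphere] by blast
  then have "norm q = 1" "max_quadratic_form B = (B *v q) \<bullet> q"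
    unfolding max_quadratic_form_def by (auto intro!: Greatest_equality)
  then show ?thesis by (rule that)
qed

text \<open>The form \<open>\<langle>M' q, q\<rangle>\<close> in the coordinates \<open>q\<^sub>i = sqrt A\<^sub>i \<beta>\<^sub>i\<close>. In these coordinates it is a sum over edges: if the points of
type \<open>j\<close> on a sphere occur in proportion to \<open>A\<^sub>j\<close>, each edge from a point of type \<open>j\<close> to a successor of type \<open>i\<close> contributes
\<open>\<beta>\<^sub>i \<beta>\<^sub>j\<close>.\<close>

definition edge_form :: "nat^'t^'t \<Rightarrow> real^'t::finite \<Rightarrow> ('t \<Rightarrow> real) \<Rightarrow> real" where
  "edge_form M A \<beta> = (\<Sum>j\<in>UNIV. \<Sum>i\<in>UNIV. real (M $ i $ j) * A $ j * \<beta> i * \<beta> j)"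

lemma M_prime_nth:
  "M_prime M A $ i $ j = A $ i powr (- 1 / 2) * real (M $ i $ j) * A $ j powr (1 / 2)"
  by (simp add: M_prime_def matrix_matrix_mult_def diag_def map_matrix_def if_distrib[of "\<lambda>x. x * _"]
      if_distrib[of "\<lambda>x. _ * x"] sum.delta sum.delta' cong: if_cong)

lemma max_quadratic_form_M_prime:
  fixes A :: "real^'t::finite"
  assumes A: "\<forall>i. A $ i > 0"
  obtains \<beta> where "(\<Sum>i\<in>UNIV. A $ i * (\<beta> i)\<^sup>2) = 1" "max_quadratic_form (M_prime M A) = edge_form M A \<beta>"
proof -
  obtain q where q: "norm q = 1" "max_quadratic_form (M_prime M A) = (M_prime M A *v q) \<bullet> q"
    using max_quadratic_form_attained .
  \<comment> \<open>The inverse square root of \<open>A\<close>; it turns \<open>q\<close> into \<open>\<beta>\<close>.\<close>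
  define r where "r i = A $ i powr (- 1 / 2)" for i
  define s where "s i = A $ i powr (1 / 2)" for i
  define \<beta> where "\<beta> i = r i * q $ i" for i
  have "A $ i * r i = s i" and inv: "s i * r i = 1" for i
    using A[rule_format, of i] powr_add[of "A $ i" 1 "- 1 / 2"] powr_add[of "A $ i" "1 / 2" "- 1 / 2"]
    by (simp_all add: r_def s_def)
  then have A\<beta>: "A $ i * \<beta> i = s i * q $ i" for i
    by (simp add: \<beta>_def mult.assoc[symmetric])
  have "A $ i * (\<beta> i)\<^sup>2 = (q $ i)\<^sup>2" for i
  proof -
    have "A $ i * (\<beta> i)\<^sup>2 = A $ i * \<beta> i * \<beta> i" by (simp add: power2_eq_square)
    also have "\<dots> = (s i * r i) * (q $ i)\<^sup>2"
      unfolding A\<beta> by (simp add: \<beta>_def power2_eq_square)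
    finally show ?thesis by (simp only: inv mult_1)
  qed
  then have "(\<Sum>i\<in>UNIV. A $ i * (\<beta> i)\<^sup>2) = q \<bullet> q" by (simp add: inner_vec_def power2_eq_square)
  then have "(\<Sum>i\<in>UNIV. A $ i * (\<beta> i)\<^sup>2) = 1" using q(1) by (simp add: norm_eq_1)
  moreover have "(M_prime M A *v q) \<bullet> q = edge_form M A \<beta>"
  proof -
    have "(M_prime M A *v q) \<bullet> q
        = (\<Sum>i\<in>UNIV. \<Sum>j\<in>UNIV. real (M $ i $ j) * (s j * q $ j) * \<beta> i)"
      by (simp add: inner_vec_def matrix_vector_mult_def M_prime_nth \<beta>_def r_def s_def sum_distrib_right
          sum_distrib_left ac_simps)
    also have "\<dots> = (\<Sum>i\<in>UNIV. \<Sum>j\<in>UNIV. real (M $ i $ j) * A $ j * \<beta> i * \<beta> j)"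
      unfolding A\<beta>[symmetric] by (simp add: ac_simps)
    also have "\<dots> = edge_form M A \<beta>" unfolding edge_form_def by (rule sum.swap)
    finally show ?thesis .
  qed
  ultimately show ?thesis using that q(2) by simp
qed

text \<open>A row of \<open>M_tilde\<close> is a nonnegative row of \<open>M\<close> divided by \<open>p\<^sub>i\<close>. Since its product with the positive vector \<open>A\<close> is
positive, so is \<open>p\<^sub>i\<close>; the default value of a division by \<open>0\<close> would give \<open>0\<close>.\<close>

lemma
  fixes A :: "real^'t::finite"
  assumes eig: "M_tilde S M *v A = exp v *s A" and A: "\<forall>i. A $ i > 0"
  shows pred_number_pos: "pred_number S M i > 0"
    and M_eigen_eq: "(\<Sum>j\<in>UNIV. real (M $ i $ j) * A $ j) = exp v * pred_number S M i * A $ i"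
proof -
  have "(M_tilde S M *v A) $ i = exp v * A $ i" by (simp add: eig)
  then have eq: "(\<Sum>j\<in>UNIV. real (M $ i $ j) * A $ j) / pred_number S M i = exp v * A $ i"
    by (simp add: M_tilde_def matrix_vector_mult_def sum_divide_distrib)
  have "0 \<le> (\<Sum>j\<in>UNIV. real (M $ i $ j) * A $ j)"
    using A by (intro sum_nonneg) (auto simp: less_imp_le)
  moreover have "0 < exp v * A $ i" using A by simp
  ultimately show p: "pred_number S M i > 0"
    unfolding eq[symmetric] by (auto simp: zero_less_divide_iff)
  show "(\<Sum>j\<in>UNIV. real (M $ i $ j) * A $ j) = exp v * pred_number S M i * A $ i"
    using eq p by (simp add: field_simps)
qed

text \<open>Since \<open>2 exp (- v / 2) \<beta>\<^sub>i \<beta>\<^sub>j \<le> exp (- v) \<beta>\<^sub>i\<^sup>2 + \<beta>\<^sub>j\<^sup>2\<close>, it remains to sum the two terms with the weights \<open>M\<^sub>i\<^sub>j A\<^sub>j\<close>: by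
the eigenvector equation the first gives \<open>(\<Sum>i. p\<^sub>i A\<^sub>i \<beta>\<^sub>i\<^sup>2)\<close>, and by the column sums of \<open>M\<close> the second gives
\<open>(\<Sum>j. (|S| - p\<^sub>j) A\<^sub>j \<beta>\<^sub>j\<^sup>2)\<close>.\<close>

lemma edge_form_le:
  fixes A :: "real^'t::finite"
  assumes eig: "M_tilde S M *v A = exp v *s A" and A: "\<forall>i. A $ i > 0"
  shows "2 * exp (- v / 2) * edge_form M A \<beta> \<le> real (card S) * (\<Sum>i\<in>UNIV. A $ i * (\<beta> i)\<^sup>2)"
proof -
  have am_gm: "2 * exp (- v / 2) * (\<beta> i * \<beta> j) \<le> exp (- v) * (\<beta> i)\<^sup>2 + (\<beta> j)\<^sup>2" for i j
  proof -
    have "0 \<le> (exp (- v / 2) * \<beta> i - \<beta> j)\<^sup>2" by simp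
    also have "\<dots> = (exp (- v / 2))\<^sup>2 * (\<beta> i)\<^sup>2 + (\<beta> j)\<^sup>2 - 2 * exp (- v / 2) * (\<beta> i * \<beta> j)"
      by (simp add: power2_eq_square algebra_simps)
    also have "(exp (- v / 2))\<^sup>2 = exp (- v)" by (simp add: power2_eq_square exp_add[symmetric])
    finally show ?thesis by simp
  qed
  have "2 * exp (- v / 2) * edge_form M A \<beta>
      = (\<Sum>j\<in>UNIV. \<Sum>i\<in>UNIV. real (M $ i $ j) * A $ j * (2 * exp (- v / 2) * (\<beta> i * \<beta> j)))"
    by (simp add: edge_form_def sum_distrib_left ac_simps)
  also have "\<dots> \<le> (\<Sum>j\<in>UNIV. \<Sum>i\<in>UNIV. real (M $ i $ j) * A $ j * (exp (- v) * (\<beta> i)\<^sup>2 + (\<beta> j)\<^sup>2))"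
    using A by (intro sum_mono mult_left_mono am_gm) (auto simp: less_imp_le)
  also have "\<dots> = (\<Sum>j\<in>UNIV. \<Sum>i\<in>UNIV. exp (- v) * (\<beta> i)\<^sup>2 * (real (M $ i $ j) * A $ j))
      + (\<Sum>j\<in>UNIV. \<Sum>i\<in>UNIV. A $ j * (\<beta> j)\<^sup>2 * real (M $ i $ j))"
    by (simp add: sum.distrib[symmetric] algebra_simps)
  also have "(\<Sum>j\<in>UNIV. \<Sum>i\<in>UNIV. exp (- v) * (\<beta> i)\<^sup>2 * (real (M $ i $ j) * A $ j))
      = (\<Sum>i\<in>UNIV. exp (- v) * (\<beta> i)\<^sup>2 * (exp v * pred_number S M i * A $ i))"
    by (subst sum.swap) (simp only: sum_distrib_left[symmetric] M_eigen_eq[OF eig A])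
  also have "\<dots> = (\<Sum>i\<in>UNIV. A $ i * (\<beta> i)\<^sup>2 * pred_number S M i)"
    by (intro sum.cong refl) (simp add: exp_minus field_simps)
  also have "(\<Sum>j\<in>UNIV. \<Sum>i\<in>UNIV. A $ j * (\<beta> j)\<^sup>2 * real (M $ i $ j))
      = (\<Sum>j\<in>UNIV. A $ j * (\<beta> j)\<^sup>2 * (real (card S) - pred_number S M j))"
    by (simp add: pred_number_def sum_distrib_left)
  also have "(\<Sum>i\<in>UNIV. A $ i * (\<beta> i)\<^sup>2 * pred_number S M i)
      + (\<Sum>j\<in>UNIV. A $ j * (\<beta> j)\<^sup>2 * (real (card S) - pred_number S M j))
      = real (card S) * (\<Sum>i\<in>UNIV. A $ i * (\<beta> i)\<^sup>2)"
    by (simp add: sum.distrib[symmetric] algebra_simps sum_distrib_left)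
  finally show ?thesis .
qed

section \<open>Counting points by type on spheres\<close>

lemma sum_by_type:
  fixes t :: "'a \<Rightarrow> 't::finite" and g :: "'t \<Rightarrow> real"
  assumes "finite X"
  shows "(\<Sum>x\<in>X. g (t x)) = (\<Sum>j\<in>UNIV. real (card {x \<in> X. t x = j}) * g j)"
proof -
  have "(\<Sum>x\<in>X. g (t x)) = (\<Sum>j\<in>UNIV. \<Sum>x\<in>{x \<in> X. t x = j}. g (t x))"
    using assms by (intro sum.group[symmetric]) auto
  also have "\<dots> = (\<Sum>j\<in>UNIV. real (card {x \<in> X. t x = j}) * g j)"
    by (intro sum.cong refl) simp
  finally show ?thesis .
qed

context symmetric_cayley
begin

definition sphere_count :: "('a \<Rightarrow> 't) \<Rightarrow> nat \<Rightarrow> 't \<Rightarrow> real" where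
  "sphere_count t n i = real (card {x \<in> carrier G. dist_one x = n \<and> t x = i})"

lemma finite_shell: "finite {x \<in> carrier G. m \<le> dist_one x \<and> dist_one x < n}"
  by (rule finite_subset[OF _ finite_ball[of n]]) auto

lemma finite_dist_eq: "finite {x \<in> carrier G. dist_one x = n}"
  by (rule finite_subset[OF _ finite_ball[of n]]) auto

lemma sum_shell:
  fixes t :: "'a \<Rightarrow> 't::finite" and h :: "nat \<Rightarrow> 't \<Rightarrow> real"
  shows "(\<Sum>x | x \<in> carrier G \<and> m \<le> dist_one x \<and> dist_one x < n. h (dist_one x) (t x))
    = (\<Sum>k\<in>{m..<n}. \<Sum>j\<in>UNIV. sphere_count t k j * h k j)"
proof -
  let ?X = "{x \<in> carrier G. m \<le> dist_one x \<and> dist_one x < n}"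
  have "(\<Sum>x\<in>?X. h (dist_one x) (t x))
      = (\<Sum>k\<in>{m..<n}. \<Sum>x\<in>{x \<in> ?X. dist_one x = k}. h (dist_one x) (t x))"
    by (intro sum.group[symmetric] finite_shell) auto
  also have "\<dots> = (\<Sum>k\<in>{m..<n}. \<Sum>j\<in>UNIV. sphere_count t k j * h k j)"
  proof (rule sum.cong)
    fix k assume k: "k \<in> {m..<n}"
    have "(\<Sum>x\<in>{x \<in> ?X. dist_one x = k}. h (dist_one x) (t x))
        = (\<Sum>x | x \<in> carrier G \<and> dist_one x = k. h k (t x))"
      using k by (intro sum.cong) auto
    also have "\<dots> = (\<Sum>j\<in>UNIV. sphere_count t k j * h k j)"
      unfolding sum_by_type[OF finite_dist_eq, of "h k" t k] sphere_count_def
      by (intro sum.cong refl) (simp add: conj_assoc)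
    finally show "(\<Sum>x\<in>{x \<in> ?X. dist_one x = k}. h (dist_one x) (t x))
        = (\<Sum>j\<in>UNIV. sphere_count t k j * h k j)" .
  qed simp
  finally show ?thesis .
qed

text \<open>The type system has finitely many exceptional points, all of which lie in some ball; the radius \<open>n0\<close> marks where
the exceptions end.\<close>

definition regular_from :: "('a \<Rightarrow> 't::finite) \<Rightarrow> nat^'t^'t \<Rightarrow> nat \<Rightarrow> bool" where
  "regular_from t M n0 \<longleftrightarrow> (\<forall>x\<in>carrier G. n0 \<le> dist_one x \<longrightarrow>
     real (card (predecessors G S x)) = pred_number S M (t x) \<and>
     (\<forall>i. card {y \<in> successors G S x. t y = i} = M $ i $ t x))"

lemma ex_regular_from:
  assumes M: "type_system G S t M"
  shows "\<exists>n0. regular_from t M n0"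
proof -
  define F where "F = (\<Union>i. {x \<in> carrier G. t x = i \<and> real (card (predecessors G S x)) \<noteq> pred_number S M i})
    \<union> (\<Union>i j. {x \<in> carrier G. t x = j \<and> card {y \<in> successors G S x. t y = i} \<noteq> M $ i $ j})"
  have "finite F"
    using card_predecessors_eq_pred_number[OF is_group finite_S generating M] M
    by (auto simp: F_def type_system_def)
  then have "finite (dist_one ` F)" by simp
  then obtain n0 where n0: "\<forall>n\<in>dist_one ` F. n < n0" using finite_nat_set_iff_bounded by auto
  have "regular_from t M n0"
    unfolding regular_from_def
  proof (intro ballI impI)
    fix x assume x: "x \<in> carrier G" "n0 \<le> dist_one x"
    then have "x \<notin> F" using n0 by auto
    then show "real (card (predecessors G S x)) = pred_number S M (t x) \<and>
       (\<forall>i. card {y \<in> successors G S x. t y = i} = M $ i $ t x)"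
      using x by (auto simp: F_def)
  qed
  then show ?thesis by blast
qed

lemma successors_carrier: "x \<in> carrier G \<Longrightarrow> y \<in> successors G S x \<Longrightarrow> y \<in> carrier G"
  using neighbors_carrier by (auto simp: successors_def)

lemma successors_dist: "y \<in> successors G S x \<Longrightarrow> dist_one y = Suc (dist_one x)"
  by (simp add: successors_def)

lemma finite_successors: "x \<in> carrier G \<Longrightarrow> finite (successors G S x)"
  using finite_neighbors by (auto simp: successors_def)

end

context bipartite_cayley
begin

text \<open>Both sides count the edges from the sphere of radius \<open>n\<close> to points of type \<open>i\<close> on the next sphere, by end points on the
left and by starting points on the right.\<close>

lemma sphere_count_Suc:
  assumes reg: "regular_from t M n0" and n: "n0 \<le> n"
  shows "pred_number S M i * sphere_count t (Suc n) i
    = (\<Sum>j\<in>UNIV. real (M $ i $ j) * sphere_count t n j)"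
proof -
  define X where "X = {x \<in> carrier G. dist_one x = n}"
  define Y where "Y = {y \<in> carrier G. dist_one y = Suc n \<and> t y = i}"
  have fX: "finite X" unfolding X_def by (rule finite_dist_eq)
  have fY: "finite Y" unfolding Y_def by (rule finite_subset[OF _ finite_dist_eq[of "Suc n"]]) auto
  have "(\<Sum>x\<in>X. \<Sum>y\<in>Y. of_bool (y \<in> successors G S x)) = (\<Sum>x\<in>X. real (M $ i $ t x))"
  proof (rule sum.cong)
    fix x assume x: "x \<in> X"
    have "Y \<inter> {y. y \<in> successors G S x} = {y \<in> successors G S x. t y = i}"
      using x by (auto simp: X_def Y_def successors_carrier successors_dist)
    moreover have "card {y \<in> successors G S x. t y = i} = M $ i $ t x"
      using x reg n by (auto simp: regular_from_def X_def)
    ultimately show "(\<Sum>y\<in>Y. of_bool (y \<in> successors G S x)) = real (M $ i $ t x)"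
      using fY by (simp add: sum_of_bool_eq)
  qed simp
  also have "\<dots> = (\<Sum>j\<in>UNIV. real (M $ i $ j) * sphere_count t n j)"
    using sum_by_type[OF fX, of "\<lambda>j. real (M $ i $ j)" t]
    by (simp add: sphere_count_def X_def conj_assoc mult.commute)
  finally have "(\<Sum>j\<in>UNIV. real (M $ i $ j) * sphere_count t n j)
      = (\<Sum>y\<in>Y. \<Sum>x\<in>X. of_bool (y \<in> successors G S x))"
    by (simp add: sum.swap[of _ X Y])
  also have "\<dots> = (\<Sum>y\<in>Y. pred_number S M i)"
  proof (rule sum.cong)
    fix y assume y: "y \<in> Y"
    have "x \<in> predecessors G S y \<longleftrightarrow> x \<in> X \<and> y \<in> successors G S x" for x
    proof (cases "x \<in> carrier G")
      case True
      then show ?thesis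
        using predecessors_iff_successors[of x y] y successors_dist[of y x]
        by (auto simp: X_def Y_def)
    next
      case False
      then show ?thesis using neighbors_carrier[of y x] y by (auto simp: X_def Y_def predecessors_def)
    qed
    then have "X \<inter> {x. y \<in> successors G S x} = predecessors G S y" by auto
    moreover have "real (card (predecessors G S y)) = pred_number S M i"
      using y reg n by (auto simp: regular_from_def Y_def)
    ultimately show "(\<Sum>x\<in>X. of_bool (y \<in> successors G S x)) = pred_number S M i"
      using fX by (simp add: sum_of_bool_eq)
  qed simp
  also have "\<dots> = pred_number S M i * sphere_count t (Suc n) i"
    by (simp add: sphere_count_def Y_def)
  finally show ?thesis by simp
qed

text \<open>The quotients \<open>u\<^sub>n i = N\<^sub>n i exp (- v n) / A\<^sub>i\<close> evolve by the matrix \<open>Q\<^sub>i\<^sub>j = M\<^sub>i\<^sub>j A\<^sub>j / (exp v p\<^sub>i A\<^sub>i)\<close>, whose rows sum to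
\<open>1\<close> because \<open>A\<close> is an eigenvector. Infiniteness of the group provides a nonempty sphere outside the exceptional
ball, which makes the limit positive.\<close>

lemma sphere_count_asymptotics:
  fixes t :: "'a \<Rightarrow> 't::finite"
  assumes inf: "infinite (carrier G)" and reg: "regular_from t M n0" and PF: "perron_frobenius M"
    and eig: "M_tilde S M *v A = exp v *s A" and A: "\<forall>i. A $ i > 0"
  shows "\<exists>c>0. \<forall>i. (\<lambda>n. sphere_count t n i * exp (- v * real n)) \<longlonglongrightarrow> c * A $ i"
proof -
  have "\<not> carrier G \<subseteq> {x \<in> carrier G. dist_one x \<le> n0}" using inf finite_ball finite_subset by blast
  then obtain x0 where x0: "x0 \<in> carrier G" "n0 \<le> dist_one x0" by force
  define n1 where "n1 = dist_one x0"
  define p where "p = pred_number S M"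
  have p: "p i > 0" for i unfolding p_def by (rule pred_number_pos[OF eig A])
  have A': "A $ i > 0" for i using A by blast
  define Q where "Q i j = real (M $ i $ j) * A $ j / (exp v * p i * A $ i)" for i j
  define u where "u n i = sphere_count t (n1 + n) i * exp (- v * real (n1 + n)) / A $ i" for n i
  have "\<exists>c>0. \<forall>i. (\<lambda>n. u n i) \<longlonglongrightarrow> c"
  proof (rule primitive_stochastic_iteration_converges[where Q = Q and M = M])
    show "Q i j \<ge> 0" for i j using A'[of i] A'[of j] p[of i] by (simp add: Q_def)
    show "(\<Sum>j\<in>UNIV. Q i j) = 1" for i
      using A'[of i] p[of i] M_eigen_eq[OF eig A, of i]
      by (simp add: Q_def sum_divide_distrib[symmetric] p_def)
    show "Q i j > 0" if "M $ i $ j > 0" for i j using that A'[of i] A'[of j] p[of i] by (simp add: Q_def)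
    show "u (Suc n) i = (\<Sum>j\<in>UNIV. Q i j * u n j)" for n i
    proof -
      have "p i * sphere_count t (Suc (n1 + n)) i
          = (\<Sum>j\<in>UNIV. real (M $ i $ j) * sphere_count t (n1 + n) j)"
        unfolding p_def using x0 by (intro sphere_count_Suc[OF reg]) (simp add: n1_def)
      then have "sphere_count t (Suc (n1 + n)) i
          = (\<Sum>j\<in>UNIV. real (M $ i $ j) * sphere_count t (n1 + n) j) / p i"
        using p[of i] by (simp add: field_simps)
      moreover have "exp (- v * real (Suc (n1 + n))) = exp (- v * real (n1 + n)) / exp v"
        by (simp add: exp_diff[symmetric] algebra_simps)
      ultimately have "u (Suc n) i = (\<Sum>j\<in>UNIV. real (M $ i $ j) * sphere_count t (n1 + n) j)
          * (exp (- v * real (n1 + n)) / (exp v * p i * A $ i))"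
        by (simp add: u_def)
      also have "\<dots> = (\<Sum>j\<in>UNIV. Q i j * u n j)"
        unfolding sum_distrib_right
      proof (rule sum.cong)
        fix j
        show "real (M $ i $ j) * sphere_count t (n1 + n) j * (exp (- v * real (n1 + n)) / (exp v * p i * A $ i))
            = Q i j * u n j"
          unfolding Q_def u_def using A'[of j] by simp
      qed simp
      finally show ?thesis .
    qed
    show "u 0 i \<ge> 0" for i using A'[of i] by (simp add: u_def sphere_count_def)
    have "finite {x \<in> carrier G. dist_one x = n1 \<and> t x = t x0}"
      by (rule finite_subset[OF _ finite_dist_eq[of n1]]) auto
    then have "sphere_count t n1 (t x0) > 0"
      using x0 unfolding sphere_count_def n1_def by (auto simp: card_gt_0_iff)
    then show "u 0 (t x0) > 0" using A' by (simp add: u_def)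
  qed (rule PF)
  then obtain c where c: "c > 0" "\<And>i. (\<lambda>n. u n i) \<longlonglongrightarrow> c" by blast
  have "(\<lambda>n. sphere_count t n i * exp (- v * real n)) \<longlonglongrightarrow> c * A $ i" for i
  proof (rule LIMSEQ_offset)
    have "(\<lambda>n. u n i * A $ i) \<longlonglongrightarrow> c * A $ i" by (intro tendsto_mult_right c)
    then show "(\<lambda>n. sphere_count t (n + n1) i * exp (- v * real (n + n1))) \<longlonglongrightarrow> c * A $ i"
      using A'[of i] by (simp add: u_def add.commute)
  qed
  then show ?thesis using c by blast
qed

end

section \<open>Test functions on shells\<close>

text \<open>If the limit were positive, long window sums far out would grow linearly, whereas \<open>h\<close> is bounded.\<close>

lemma LIMSEQ_nonpos_of_window_sums_le:
  fixes g h :: "nat \<Rightarrow> real"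
  assumes g: "g \<longlonglongrightarrow> L" and h: "h \<longlonglongrightarrow> H"
    and le: "\<And>m n. n0 \<le> m \<Longrightarrow> m \<le> n \<Longrightarrow> (\<Sum>k\<in>{m..<n}. g k) \<le> h n"
  shows "L \<le> 0"
proof (rule ccontr)
  assume "\<not> L \<le> 0"
  then have L: "L > 0" by simp
  have "\<forall>\<^sub>F n in sequentially. L / 2 < g n" by (rule order_tendstoD[OF g]) (use L in simp)
  moreover have "\<forall>\<^sub>F n in sequentially. h n < H + 1" by (rule order_tendstoD[OF h]) simp
  ultimately have "\<forall>\<^sub>F n in sequentially. L / 2 < g n \<and> h n < H + 1 \<and> n0 \<le> n"
    using eventually_ge_at_top[of n0] by eventually_elim auto
  then obtain m where m: "\<And>n. n \<ge> m \<Longrightarrow> L / 2 < g n \<and> h n < H + 1 \<and> n0 \<le> n"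
    by (auto simp: eventually_sequentially)
  obtain k :: nat where k: "H + 1 < real k * (L / 2)" 
    using reals_Archimedean3[of "L / 2"] half_gt_zero[OF L] by blast
  have "real k * (L / 2) = (\<Sum>i\<in>{m..<m + k}. L / 2)" by simp
  also have "\<dots> \<le> (\<Sum>i\<in>{m..<m + k}. g i)" using m by (intro sum_mono) (auto simp: less_imp_le)
  also have "\<dots> \<le> h (m + k)" using m by (intro le) auto
  also have "\<dots> < H + 1" using m by simp
  finally show False using k by simp
qed

context bipartite_cayley
begin

text \<open>Every edge joins a point to a successor of it in exactly one of its two directions, whence the factor \<open>2\<close>.\<close>

lemma inner_walk_sum_eq:
  assumes B: "finite B" "B \<subseteq> carrier G" and f: "\<And>x. x \<in> carrier G \<Longrightarrow> x \<notin> B \<Longrightarrow> f x = 0"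
  shows "inner_carrier G (walk_sum f) f = 2 * (\<Sum>x\<in>B. f x * (\<Sum>y\<in>successors G S x. f y))"
proof -
  have restrict: "(\<Sum>y\<in>N. f y) = (\<Sum>y\<in>B. of_bool (y \<in> N) * f y)"
    if "finite N" "N \<subseteq> carrier G" for N
  proof -
    have "(\<Sum>y\<in>N. f y) = (\<Sum>y\<in>B \<inter> N. f y)"
      using that f by (intro sum.mono_neutral_right) auto
    also have "\<dots> = (\<Sum>y\<in>B. of_bool (y \<in> N) * f y)"
      using B(1) by (simp add: sum.inter_restrict of_bool_def if_distrib[of "\<lambda>x. x * _"] cong: if_cong)
    finally show ?thesis .
  qed
  have succ: "(\<Sum>y\<in>successors G S x. f y) = (\<Sum>y\<in>B. of_bool (y \<in> successors G S x) * f y)"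
    if "x \<in> carrier G" for x
    using that by (intro restrict finite_successors) (auto simp: successors_carrier)
  have "inner_carrier G (walk_sum f) f = (\<Sum>x\<in>B. walk_sum f x * f x)"
    using B f by (intro inner_carrier_eq_sum) auto
  also have "\<dots> = (\<Sum>x\<in>B. (\<Sum>y\<in>B. of_bool (y \<in> neighbors G S x) * f y) * f x)"
  proof (rule sum.cong)
    fix x assume "x \<in> B"
    then have x: "x \<in> carrier G" using B by auto
    have "walk_sum f x = (\<Sum>y\<in>neighbors G S x. f y)" by (simp add: sum_neighbors[OF x] walk_sum_def)
    also have "\<dots> = (\<Sum>y\<in>B. of_bool (y \<in> neighbors G S x) * f y)"
      using x by (intro restrict finite_neighbors) (auto simp: neighbors_carrier)
    finally show "walk_sum f x * f x = (\<Sum>y\<in>B. of_bool (y \<in> neighbors G S x) * f y) * f x" by simp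
  qed simp
  also have "\<dots> = (\<Sum>x\<in>B. \<Sum>y\<in>B. of_bool (y \<in> successors G S x) * (f x * f y))
      + (\<Sum>x\<in>B. \<Sum>y\<in>B. of_bool (x \<in> successors G S y) * (f x * f y))"
    unfolding sum_distrib_right sum.distrib[symmetric]
    using B(2) by (intro sum.cong refl) (simp add: of_bool_neighbors subset_iff algebra_simps)
  also have "(\<Sum>x\<in>B. \<Sum>y\<in>B. of_bool (x \<in> successors G S y) * (f x * f y))
      = (\<Sum>x\<in>B. \<Sum>y\<in>B. of_bool (y \<in> successors G S x) * (f x * f y))"
    by (subst sum.swap) (simp add: mult.commute)
  also have "(\<Sum>x\<in>B. \<Sum>y\<in>B. of_bool (y \<in> successors G S x) * (f x * f y))
      = (\<Sum>x\<in>B. f x * (\<Sum>y\<in>successors G S x. f y))"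
    using B(2) by (intro sum.cong refl) (simp add: succ subset_iff sum_distrib_left ac_simps)
  finally show ?thesis by simp
qed

text \<open>The Rayleigh inequality for the function that equals \<open>\<beta> (t x) exp (- v d(x) / 2)\<close> on the shell \<open>m \<le> d(x) \<le> n\<close>. The exponent
is chosen so that squares of values cancel the growth of the spheres. The left-hand sum omits \<open>n\<close>, because the successors of
points on the outermost sphere lie outside the support.\<close>

lemma Rayleigh_shell:
  fixes t :: "'a \<Rightarrow> 't::finite" and \<beta> :: "'t \<Rightarrow> real" and v :: real
  assumes ne: "S \<noteq> {}" and reg: "regular_from t M n0" and m: "n0 \<le> m" "m \<le> n"
  defines "w \<equiv> \<lambda>k i. sphere_count t k i * exp (- v * real k)"
  shows "(\<Sum>k\<in>{m..<n}. 2 * exp (- v / 2) * (\<Sum>j\<in>UNIV. w k j * (\<beta> j * (\<Sum>i\<in>UNIV. real (M $ i $ j) * \<beta> i))))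
    \<le> real (card S) * spectral_radius_srw G S * (\<Sum>k\<in>{m..<Suc n}. \<Sum>j\<in>UNIV. w k j * (\<beta> j)\<^sup>2)"
proof -
  define e where "e k = exp (- v * real k / 2)" for k :: nat
  have e2: "e k * e k = exp (- v * real k)" for k by (simp add: e_def exp_add[symmetric])
  have eS: "e (Suc k) = exp (- v / 2) * e k" for k by (simp add: e_def exp_add[symmetric] field_simps)
  define B where "B = {x \<in> carrier G. m \<le> dist_one x \<and> dist_one x < Suc n}"
  define B' where "B' = {x \<in> carrier G. m \<le> dist_one x \<and> dist_one x < n}"
  define f where "f x = (if x \<in> B then \<beta> (t x) * e (dist_one x) else 0)" for x
  have fB: "finite B" unfolding B_def by (rule finite_shell)
  have BC: "B \<subseteq> carrier G" and BB: "B' \<subseteq> B" by (auto simp: B_def B'_def)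
  have f0: "x \<notin> B \<Longrightarrow> f x = 0" for x by (simp add: f_def)
  have "finitely_supported G f"
    unfolding finitely_supported_def by (rule finite_subset[OF _ fB]) (auto simp: f_def)
  have "inner_carrier G f f = (\<Sum>x\<in>B. f x * f x)"
    using f0 by (intro inner_carrier_eq_sum fB BC) auto
  also have "\<dots> = (\<Sum>x\<in>B. (\<beta> (t x))\<^sup>2 * exp (- v * real (dist_one x)))"
    unfolding e2[symmetric] by (intro sum.cong refl) (simp add: f_def power2_eq_square ac_simps)
  also have "\<dots> = (\<Sum>k\<in>{m..<Suc n}. \<Sum>j\<in>UNIV. w k j * (\<beta> j)\<^sup>2)"
    unfolding B_def using sum_shell[of "\<lambda>k j. (\<beta> j)\<^sup>2 * exp (- v * real k)" t m "Suc n"]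
    by (simp only: w_def ac_simps)
  finally have ff: "inner_carrier G f f = (\<Sum>k\<in>{m..<Suc n}. \<Sum>j\<in>UNIV. w k j * (\<beta> j)\<^sup>2)" .
  have "inner_carrier G (walk_sum f) f = 2 * (\<Sum>x\<in>B. f x * (\<Sum>y\<in>successors G S x. f y))"
    using f0 by (intro inner_walk_sum_eq fB BC) auto
  also have "(\<Sum>x\<in>B. f x * (\<Sum>y\<in>successors G S x. f y))
      = (\<Sum>x\<in>B'. f x * (\<Sum>y\<in>successors G S x. f y))"
  proof (intro sum.mono_neutral_right fB BB ballI)
    fix x assume "x \<in> B - B'"
    then have "dist_one x = n" by (auto simp: B_def B'_def)
    then have "f y = 0" if "y \<in> successors G S x" for y
      using successors_dist[OF that] by (intro f0) (simp add: B_def)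
    then show "f x * (\<Sum>y\<in>successors G S x. f y) = 0" by simp
  qed
  also have "\<dots> = (\<Sum>x\<in>B'. exp (- v / 2) * exp (- v * real (dist_one x))
      * (\<beta> (t x) * (\<Sum>i\<in>UNIV. real (M $ i $ t x) * \<beta> i)))"
  proof (rule sum.cong)
    fix x assume x: "x \<in> B'"
    then have xc: "x \<in> carrier G" and xd: "m \<le> dist_one x" "dist_one x < n" by (auto simp: B'_def)
    have "(\<Sum>y\<in>successors G S x. f y) = (\<Sum>y\<in>successors G S x. e (Suc (dist_one x)) * \<beta> (t y))"
    proof (rule sum.cong)
      fix y assume y: "y \<in> successors G S x"
      have "y \<in> B" using successors_carrier[OF xc y] successors_dist[OF y] xd by (simp add: B_def)
      then show "f y = e (Suc (dist_one x)) * \<beta> (t y)" by (simp add: f_def successors_dist[OF y])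
    qed simp
    also have "\<dots> = e (Suc (dist_one x)) * (\<Sum>y\<in>successors G S x. \<beta> (t y))"
      by (simp add: sum_distrib_left)
    also have "(\<Sum>y\<in>successors G S x. \<beta> (t y)) = (\<Sum>i\<in>UNIV. real (M $ i $ t x) * \<beta> i)"
    proof -
      have "card {y \<in> successors G S x. t y = i} = M $ i $ t x" for i
        using reg xc xd m by (auto simp: regular_from_def)
      then show ?thesis by (simp add: sum_by_type[OF finite_successors[OF xc]])
    qed
    finally show "f x * (\<Sum>y\<in>successors G S x. f y) = exp (- v / 2) * exp (- v * real (dist_one x))
      * (\<beta> (t x) * (\<Sum>i\<in>UNIV. real (M $ i $ t x) * \<beta> i))"
      using x BB unfolding e2[symmetric] by (simp add: f_def eS subset_iff ac_simps)
  qed simp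
  also have "\<dots> = (\<Sum>k\<in>{m..<n}. \<Sum>j\<in>UNIV. sphere_count t k j *
      (exp (- v / 2) * exp (- v * real k) * (\<beta> j * (\<Sum>i\<in>UNIV. real (M $ i $ j) * \<beta> i))))"
    unfolding B'_def
    using sum_shell[of "\<lambda>k j. exp (- v / 2) * exp (- v * real k) * (\<beta> j * (\<Sum>i\<in>UNIV. real (M $ i $ j) * \<beta> i))" t m n] .
  also have "2 * \<dots> = (\<Sum>k\<in>{m..<n}. 2 * exp (- v / 2) *
      (\<Sum>j\<in>UNIV. w k j * (\<beta> j * (\<Sum>i\<in>UNIV. real (M $ i $ j) * \<beta> i))))"
    unfolding sum_distrib_left[of _ _ UNIV] sum_distrib_left[of 2]
    by (intro sum.cong refl) (simp only: w_def ac_simps sum_distrib_left)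
  finally show ?thesis
    using Rayleigh_quotient_le_spectral_radius[OF ne \<open>finitely_supported G f\<close>] ff by simp
qed

text \<open>In \<open>Rayleigh_shell\<close> the summands of both sides converge as the shell moves outwards. The last sphere, which occurs on the
right-hand side only, contributes a bounded amount, so for wide shells the limits of the summands satisfy the same
inequality.\<close>

lemma edge_form_le_spectral_radius_infinite:
  fixes t :: "'a \<Rightarrow> 't::finite"
  assumes inf: "infinite (carrier G)" and ne: "S \<noteq> {}"
    and M: "type_system G S t M" and PF: "perron_frobenius M"
    and eig: "M_tilde S M *v A = exp v *s A" and A: "\<forall>i. A $ i > 0"
  shows "2 * exp (- v / 2) * edge_form M A \<beta>
    \<le> real (card S) * spectral_radius_srw G S * (\<Sum>i\<in>UNIV. A $ i * (\<beta> i)\<^sup>2)"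
proof -
  obtain n0 where reg: "regular_from t M n0" using ex_regular_from[OF M] by blast
  define w where "w k i = sphere_count t k i * exp (- v * real k)" for k i
  obtain c where c: "c > 0" "\<And>i. (\<lambda>n. w n i) \<longlonglongrightarrow> c * A $ i"
    using sphere_count_asymptotics[OF inf reg PF eig A] unfolding w_def by blast
  define \<kappa> where "\<kappa> = real (card S) * spectral_radius_srw G S"
  define E where "E k = (\<Sum>j\<in>UNIV. w k j * (\<beta> j)\<^sup>2)" for k
  define F where "F k = 2 * exp (- v / 2) *
    (\<Sum>j\<in>UNIV. w k j * (\<beta> j * (\<Sum>i\<in>UNIV. real (M $ i $ j) * \<beta> i)))" for k
  define E' where "E' = (\<Sum>j\<in>UNIV. c * A $ j * (\<beta> j)\<^sup>2)"
  define F' where "F' = 2 * exp (- v / 2) *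
    (\<Sum>j\<in>UNIV. c * A $ j * (\<beta> j * (\<Sum>i\<in>UNIV. real (M $ i $ j) * \<beta> i)))"
  have E: "E \<longlonglongrightarrow> E'" unfolding E_def E'_def by (intro tendsto_intros c)
  have F: "F \<longlonglongrightarrow> F'" unfolding F_def F'_def by (intro tendsto_intros c)
  have "F' - \<kappa> * E' \<le> 0"
  proof (rule LIMSEQ_nonpos_of_window_sums_le)
    show "(\<lambda>k. F k - \<kappa> * E k) \<longlonglongrightarrow> F' - \<kappa> * E'" by (intro tendsto_intros E F)
    show "(\<lambda>k. \<kappa> * E k) \<longlonglongrightarrow> \<kappa> * E'" by (intro tendsto_intros E)
    fix m n assume mn: "n0 \<le> m" "m \<le> n"
    have "(\<Sum>k\<in>{m..<n}. F k) \<le> \<kappa> * (\<Sum>k\<in>{m..<Suc n}. E k)"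
      using Rayleigh_shell[OF ne reg mn, of v \<beta>] by (simp only: F_def E_def \<kappa>_def w_def)
    then show "(\<Sum>k\<in>{m..<n}. F k - \<kappa> * E k) \<le> \<kappa> * E n"
      using mn by (simp add: sum_subtractf sum_distrib_left algebra_simps)
  qed
  moreover have "E' = c * (\<Sum>i\<in>UNIV. A $ i * (\<beta> i)\<^sup>2)"
    by (simp add: E'_def sum_distrib_left mult.assoc)
  moreover have "F' = c * (2 * exp (- v / 2) * edge_form M A \<beta>)"
    by (simp add: F'_def edge_form_def sum_distrib_left ac_simps)
  ultimately have "c * (2 * exp (- v / 2) * edge_form M A \<beta> - \<kappa> * (\<Sum>i\<in>UNIV. A $ i * (\<beta> i)\<^sup>2)) \<le> 0"
    by (simp add: algebra_simps)
  then show ?thesis using c(1) by (simp add: mult_le_0_iff \<kappa>_def)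
qed

end

section \<open>The lower bound for the spectral radius\<close>

context symmetric_cayley
begin

text \<open>On a finite group the constant function \<open>1\<close> has Rayleigh quotient \<open>|S|\<close>.\<close>

lemma spectral_radius_finite:
  assumes fin: "finite (carrier G)" and ne: "S \<noteq> {}"
  shows "spectral_radius_srw G S \<ge> 1"
proof -
  let ?f = "\<lambda>_. 1 :: real"
  have k: "real (card S) > 0" using ne finite_S by (simp add: card_gt_0_iff)
  have cG: "real (card (carrier G)) > 0" using fin by (auto simp: card_gt_0_iff)
  have "inner_carrier G (walk_sum ?f) ?f \<le> real (card S) * spectral_radius_srw G S * inner_carrier G ?f ?f"
    using fin by (intro Rayleigh_quotient_le_spectral_radius ne) (simp add: finitely_supported_def)
  then have "real (card S) * real (card (carrier G))
      \<le> real (card S) * spectral_radius_srw G S * real (card (carrier G))"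
    using fin by (simp add: inner_carrier_def walk_sum_def mult.commute)
  then show ?thesis using k cG by simp
qed

end

theorem theorem1p4:
  fixes G :: "('a, 'b) monoid_scheme"
    and S :: "'a set"
    and t :: "'a \<Rightarrow> 't::finite"
    and M :: "nat^'t^'t"
    and v :: real
    and A :: "real^'t"
  assumes "group G" and "countable (carrier G)"
    and "finite S" and "symmetric_generating_set G S"
    and "no_odd_cycle (cayley_graph G S)"
    and "type_system G S t M" and "perron_frobenius M"
    and "dominating_eigenvalue (M_tilde S M) (exp v)"
    and "M_tilde S M *v A = exp v *s A" and "\<forall>i. A $ i > 0"
  shows "spectral_radius_srw G S
           \<ge> 2 * exp (- v / 2) * max_quadratic_form (M_prime M A) / real (card S)"
proof -
  interpret group G by fact
  interpret bipartite_cayley G S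
    by unfold_locales (rule assms)+
  note eig = assms(9) and A = assms(10)
  \<comment> \<open>For empty \<open>S\<close> every \<open>p\<^sub>i\<close> would be at most \<open>0\<close>.\<close>
  have "S \<noteq> {}"
  proof
    assume "S = {}"
    then have "pred_number S M i \<le> 0" for i by (simp add: pred_number_def sum_nonneg)
    then show False using pred_number_pos[OF eig A] by (meson not_less)
  qed
  then have k: "real (card S) > 0" using finite_S by (simp add: card_gt_0_iff)
  obtain \<beta> where \<beta>: "(\<Sum>i\<in>UNIV. A $ i * (\<beta> i)\<^sup>2) = 1"
    "max_quadratic_form (M_prime M A) = edge_form M A \<beta>"
    using max_quadratic_form_M_prime[OF A] .
  have "2 * exp (- v / 2) * edge_form M A \<beta> \<le> real (card S) * spectral_radius_srw G S"
  proof (cases "finite (carrier G)")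
    case True
    have "2 * exp (- v / 2) * edge_form M A \<beta> \<le> real (card S)"
      using edge_form_le[OF eig A, of \<beta>] \<beta> by simp
    also have "\<dots> \<le> real (card S) * spectral_radius_srw G S"
      using spectral_radius_finite[OF True \<open>S \<noteq> {}\<close>] k by simp
    finally show ?thesis .
  next
    case False
    then show ?thesis
      using edge_form_le_spectral_radius_infinite[OF False \<open>S \<noteq> {}\<close> assms(6,7) eig A, of \<beta>] \<beta> by simp
  qed
  then show ?thesis using k \<beta> by (simp add: divide_le_eq mult.commute)
qed

end
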